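(* Let $K\subset\mathbb R^n$ be a convex body with $0\in\operatorname{int}(K)$ and let $K^\circ$ be its polar convex body. (i) The diagram with objects $\mathcal F_K,\mathcal E_K,\mathcal T_K,\mathcal N_K,\mathcal F_{K^\circ},\mathcal E_{K^\circ},\mathcal T_{K^\circ},\mathcal N_{K^\circ}$ and with the following arrows, for each $(X,Y)\in\{(K,K^\circ),(K^\circ,K)\}$, is well-defined and commutes (any two directed compositions of arrows with the same source and the same target are equal): $\mathrm{cl}_{\mathcal N}:\mathcal T_X\to\mathcal N_X$; $\Phi:\mathcal T_X\to\mathcal E_X$; $\mathrm{cl}_{\mathcal E}:\mathcal F_X\to\mathcal E_X$; $\Psi:\mathcal F_X\to\mathcal N_X$; $\mathcal C_X:\mathcal F_X\to\mathcal E_{Y}$; $\mathrm{pos}:\mathcal F_X\to\mathcal T_{Y}$; $\mathrm{pos}:\mathcal E_X\to\mathcal N_{Y}$; $\Phi|_{\mathcal N_X}:\mathcal N_X\to\mathcal E_X$; $\Psi|_{\mathcal E_X}:\mathcal E_X\to\mathcal N_X$; $\mathcal C_X|_{\mathcal E_X}:\mathcal E_X\to\mathcal E_{Y}$. (ii) The closure operations $\mathrm{cl}_{\mathcal N}$ and $\mathrm{cl}_{\mathcal E}$ are isotone join-morphisms $f$ satisfying $f(a\wedge b)\le f(a)\wedge f(b)$ for all $a,b$; their restrictions to normal cones resp. exposed faces are the identity map. (iii) The mappings $\Phi$, $\Psi$ and the conjugate face maps $\mathcal C_K$ and $\mathcal C_{K^\circ}$ are antitone dual join-morphisms $f$ satisfying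 $f(a\wedge b)\ge f(a)\vee f(b)$ for all $a,b$; their restrictions to normal cones (for $\Phi$) resp. exposed faces (for $\Psi$, $\mathcal C_K$, $\mathcal C_{K^\circ}$) define dual lattice isomorphisms $\mathcal N_X\to\mathcal E_X$, $\mathcal E_X\to\mathcal N_X$ ($X\in\{K,K^\circ\}$), $\mathcal E_K\to\mathcal E_{K^\circ}$ and $\mathcal E_{K^\circ}\to\mathcal E_K$, respectively. (iv) The positive hull operator $\mathrm{pos}$ defines lattice isomorphisms $\mathcal F_X\to\mathcal T_Y$ and $\mathcal E_X\to\mathcal N_Y$ for $(X,Y)\in\{(K,K^\circ),(K^\circ,K)\}$.
   Context: $\mathbb R^n$ ($n\ge1$) carries the standard scalar product. A convex body is a compact convex set. The polar of $K$ is $K^\circ=\{u\in\mathbb R^n\mid\langle u,v\rangle\le 1\ \forall v\in K\}$; it is a convex body with $0\in\operatorname{int}(K^\circ)$ and $(K^\circ)^\circ=K$. Below $C$ stands for $K$ or $K^\circ$. Faces. A face of $C$ is a convex subset $F\subset C$ such that $x,y,z\in C$, $y\in F$ and $y\in\,]x,z[\,=\{(1-\lambda)x+\lambda z\mid 0<\lambda<1\}$ imply $x,z\in F$. Put $h_C(u)=\sup\{\langle x,u\rangle\mid x\in C\}$ and, for $u\ne 0$, $H_C(u)=\{x\in\mathbb R^n\mid\langle x,u\rangle=h_C(u)\}$. The exposed faces of $C$ are the non-empty sets of the form $C\cap H_C(u)$, $u\neq 0$, together with $\emptyset$ and $C$. $\mathcal F_C$ and $\mathcal E_C\subset\mathcal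 F_C$ denote the sets of faces and exposed faces. Normal and touching cones. The normal cone of $C$ at $x\in C$ is $N(x)=\{u\in\mathbb R^n\mid\langle u,y-x\rangle\le 0\ \forall y\in C\}$; $\mathbb R^n$ is also a normal cone by definition. A touching cone of $C$ is any non-empty face of any normal cone of $C$. $\mathcal N_C\subset\mathcal T_C$ denote the sets of normal cones and touching cones. $\mathcal F_C,\mathcal E_C,\mathcal T_C,\mathcal N_C$ are ordered by inclusion and are complete lattices with intersection as infimum; $\vee,\wedge$ are always taken in the lattice which is the domain, resp. the stated codomain, of the map considered. Maps. $\Phi:\mathcal T_C\to\mathcal E_C$: $\Phi(\{0\})=C$ (here $\{0\}=\mathrm{lin}(C)^\perp$, since $C$ has non-empty interior), $\Phi(\mathbb R^n)=\emptyset$, and otherwise $\Phi(T)=C\cap H_C(u)$ for any non-zero $u$ in the relative interior of $T$ (well-defined). $\Psi:\mathcal F_C\to\mathcal N_C$: $\Psi(\emptyset)=\mathbb R^n$ and $\Psi(F)=N(x)$ for any $x$ in the relative interior of $F\neq\emptyset$ (well-defined). $\mathrm{cl}_{\mathcal N}:\mathcal T_C\to\mathcal N_C$ sends $T$ to the intersection of all normal cones of $C$ containing $T$; $\mathrm{cl}_{\mathcal E}:\mathcal F_C\to\mathcal E_C$ sends $F$ to the intersection of all exposed faces of $C$ containing $F$. The conjugate face map is $\mathcal C_K(F)=\{v\in K^\circ\mid\langle v,u\rangle=1\ \forall u\in F\}$ for $F\in\mathcal F_K$, and analogously $\mathcal C_{K^\circ}$ (with $(K^\circ)^\circ=K$).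 The positive hull of $X\subset\mathbb R^n$ is $\mathrm{pos}(X)=\{\lambda x\mid\lambda\ge0,\ x\in X\}$ if $X\neq\emptyset$, and $\mathrm{pos}(\emptyset)=\{0\}$. Lattice terms. A map $\theta:L\to M$ of lattices is isotone (antitone) if $x\le y$ implies $\theta(x)\le\theta(y)$ (resp. $\theta(x)\ge\theta(y)$); a join-morphism if $\theta(x\vee y)=\theta(x)\vee\theta(y)$; a dual join-morphism if $\theta(x\vee y)=\theta(x)\wedge\theta(y)$; a dual meet-morphism if $\theta(x\wedge y)=\theta(x)\vee\theta(y)$. A dual lattice isomorphism is a bijection which is a dual join-morphism and a dual meet-morphism. *)

theory Defs
  imports "HOL-Analysis.Analysis" "HOL-Algebra.Lattice"
begin

section \<open>Faces and cones of a convex body\<close>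

definition polar :: "'a::euclidean_space set \<Rightarrow> 'a set" where
  "polar K = {u. \<forall>v\<in>K. u \<bullet> v \<le> 1}"

definition support_fun :: "'a::euclidean_space set \<Rightarrow> 'a \<Rightarrow> real" where
  "support_fun C u = (SUP x\<in>C. x \<bullet> u)"

definition support_plane :: "'a::euclidean_space set \<Rightarrow> 'a \<Rightarrow> 'a set" where
  "support_plane C u = {x. x \<bullet> u = support_fun C u}"

definition faces :: "'a::euclidean_space set \<Rightarrow> 'a set set" where
  "faces C = {F. F face_of C}"

text \<open>The library notion of exposed face also admits the zero functional, which yields precisely
  the two improper exposed faces, the empty set and \<open>C\<close>; see \<open>exposed_faces_eq\<close> below.\<close>

definition exposed_faces :: "'a::euclidean_space set \<Rightarrow> 'a set set" where
  "exposed_faces C = {F. F exposed_face_of C}"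

lemma exposed_faces_eq:
  assumes "compact C" "convex C"
  shows "exposed_faces C = {F. F \<noteq> {} \<and> (\<exists>u. u \<noteq> 0 \<and> F = C \<inter> support_plane C u)} \<union> {{}, C}"
proof (intro equalityI subsetI)
  fix F assume "F \<in> exposed_faces C"
  then obtain a b where ab: "C \<subseteq> {x. a \<bullet> x \<le> b}" "F = C \<inter> {x. a \<bullet> x = b}"
    unfolding exposed_faces_def exposed_face_of_def by blast
  show "F \<in> {F. F \<noteq> {} \<and> (\<exists>u. u \<noteq> 0 \<and> F = C \<inter> support_plane C u)} \<union> {{}, C}"
  proof (cases "F = {} \<or> a = 0")
    case True
    then show ?thesis using ab by auto
  next
    case False
    then obtain y where y: "y \<in> C" "a \<bullet> y = b" using ab by auto
    have "support_fun C a = b"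
      unfolding support_fun_def
    proof (rule cSup_eq_maximum)
      show "b \<in> (\<lambda>x. x \<bullet> a) ` C" using y by (force simp: inner_commute)
      show "z \<le> b" if "z \<in> (\<lambda>x. x \<bullet> a) ` C" for z
        using that ab(1) by (auto simp: inner_commute)
    qed
    then have "F = C \<inter> support_plane C a"
      using ab(2) by (auto simp: support_plane_def inner_commute)
    then show ?thesis using False by blast
  qed
next
  fix F assume "F \<in> {F. F \<noteq> {} \<and> (\<exists>u. u \<noteq> 0 \<and> F = C \<inter> support_plane C u)} \<union> {{}, C}"
  then consider "F = {}" | "F = C" | u where "F = C \<inter> support_plane C u" by blast
  then show "F \<in> exposed_faces C"
  proof cases
    case 3
    have "bdd_above ((\<lambda>x. x \<bullet> u) ` C)"
      by (intro bounded_imp_bdd_above compact_imp_bounded compact_continuous_image assms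
          continuous_intros)
    then have le: "u \<bullet> x \<le> support_fun C u" if "x \<in> C" for x
      unfolding support_fun_def using that by (subst inner_commute) (rule cSUP_upper)
    have "F = C \<inter> {x. u \<bullet> x = support_fun C u}"
      using 3 by (simp add: support_plane_def inner_commute)
    then show ?thesis
      using exposed_face_of_Int_supporting_hyperplane_le[OF assms(2) le]
      by (simp add: exposed_faces_def)
  qed (use assms(2) in \<open>auto simp: exposed_faces_def\<close>)
qed

definition normal_cone :: "'a::euclidean_space set \<Rightarrow> 'a \<Rightarrow> 'a set" where
  "normal_cone C x = {u. \<forall>y\<in>C. u \<bullet> (y - x) \<le> 0}"

definition normal_cones :: "'a::euclidean_space set \<Rightarrow> 'a set set" where
  "normal_cones C = insert UNIV (normal_cone C ` C)"

definition touching_cones :: "'a::euclidean_space set \<Rightarrow> 'a set set" where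
  "touching_cones C = {T. T \<noteq> {} \<and> (\<exists>N\<in>normal_cones C. T face_of N)}"


section \<open>The maps\<close>

text \<open>\<open>Phi\<close> and \<open>Psi\<close> pick an arbitrary point of the relative interior;
  \<open>Phi_indep\<close> and \<open>Psi_indep\<close> say that such a point exists and that the choice is irrelevant.\<close>

definition Phi :: "'a::euclidean_space set \<Rightarrow> 'a set \<Rightarrow> 'a set" where
  "Phi C T = (if T = {0} then C else if T = UNIV then {}
     else C \<inter> support_plane C (SOME u. u \<in> rel_interior T \<and> u \<noteq> 0))"

definition Phi_indep :: "'a::euclidean_space set \<Rightarrow> bool" where
  "Phi_indep C \<longleftrightarrow> (\<forall>T \<in> touching_cones C - {{0}, UNIV}.
     rel_interior T - {0} \<noteq> {} \<and>
     (\<forall>u \<in> rel_interior T - {0}. Phi C T = C \<inter> support_plane C u))"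

definition Psi :: "'a::euclidean_space set \<Rightarrow> 'a set \<Rightarrow> 'a set" where
  "Psi C F = (if F = {} then UNIV else normal_cone C (SOME x. x \<in> rel_interior F))"

definition Psi_indep :: "'a::euclidean_space set \<Rightarrow> bool" where
  "Psi_indep C \<longleftrightarrow> (\<forall>F \<in> faces C - {{}}.
     rel_interior F \<noteq> {} \<and> (\<forall>x \<in> rel_interior F. Psi C F = normal_cone C x))"

definition cl_normal :: "'a::euclidean_space set \<Rightarrow> 'a set \<Rightarrow> 'a set" where
  "cl_normal C T = \<Inter>{N \<in> normal_cones C. T \<subseteq> N}"

definition cl_exposed :: "'a::euclidean_space set \<Rightarrow> 'a set \<Rightarrow> 'a set" where
  "cl_exposed C F = \<Inter>{E \<in> exposed_faces C. F \<subseteq> E}"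

text \<open>For \<open>C = polar K\<close> the values lie in \<open>polar (polar K)\<close>, which is \<open>K\<close> by the bipolar theorem.\<close>

definition conj_face :: "'a::euclidean_space set \<Rightarrow> 'a set \<Rightarrow> 'a set" where
  "conj_face C F = {v \<in> polar C. \<forall>u\<in>F. v \<bullet> u = 1}"

definition pos :: "'a::euclidean_space set \<Rightarrow> 'a set" where
  "pos X = (if X = {} then {0} else {c *\<^sub>R x | c x. 0 \<le> c \<and> x \<in> X})"


section \<open>Lattice morphisms\<close>

definition incl :: "'a set set \<Rightarrow> 'a set gorder" where
  "incl \<L> = \<lparr>carrier = \<L>, eq = (=), le = (\<subseteq>)\<rparr>"

definition antitone :: "('a, 'c) gorder_scheme \<Rightarrow> ('b, 'd) gorder_scheme \<Rightarrow> ('a \<Rightarrow> 'b) \<Rightarrow> bool" where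
  "antitone L M f \<longleftrightarrow> isotone L (inv_gorder M) f"

definition dual_join_pres ::
    "('a, 'c) gorder_scheme \<Rightarrow> ('b, 'd) gorder_scheme \<Rightarrow> ('a \<Rightarrow> 'b) \<Rightarrow> bool" where
  "dual_join_pres L M f \<longleftrightarrow> lattice L \<and> lattice M \<and>
     (\<forall>x\<in>carrier L. \<forall>y\<in>carrier L. f (x \<squnion>\<^bsub>L\<^esub> y) = f x \<sqinter>\<^bsub>M\<^esub> f y)"

definition dual_meet_pres ::
    "('a, 'c) gorder_scheme \<Rightarrow> ('b, 'd) gorder_scheme \<Rightarrow> ('a \<Rightarrow> 'b) \<Rightarrow> bool" where
  "dual_meet_pres L M f \<longleftrightarrow> lattice L \<and> lattice M \<and>
     (\<forall>x\<in>carrier L. \<forall>y\<in>carrier L. f (x \<sqinter>\<^bsub>L\<^esub> y) = f x \<squnion>\<^bsub>M\<^esub> f y)"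

definition lattice_iso ::
    "('a, 'c) gorder_scheme \<Rightarrow> ('b, 'd) gorder_scheme \<Rightarrow> ('a \<Rightarrow> 'b) \<Rightarrow> bool" where
  "lattice_iso L M f \<longleftrightarrow> bij_betw f (carrier L) (carrier M) \<and> join_pres L M f \<and> meet_pres L M f"

definition dual_lattice_iso ::
    "('a, 'c) gorder_scheme \<Rightarrow> ('b, 'd) gorder_scheme \<Rightarrow> ('a \<Rightarrow> 'b) \<Rightarrow> bool" where
  "dual_lattice_iso L M f \<longleftrightarrow>
     bij_betw f (carrier L) (carrier M) \<and> dual_join_pres L M f \<and> dual_meet_pres L M f"

definition isotone_join_morphism ::
    "('a, 'c) gorder_scheme \<Rightarrow> ('b, 'd) gorder_scheme \<Rightarrow> ('a \<Rightarrow> 'b) \<Rightarrow> bool" where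
  "isotone_join_morphism L M f \<longleftrightarrow>
     f \<in> carrier L \<rightarrow> carrier M \<and> isotone L M f \<and> join_pres L M f \<and>
     (\<forall>a\<in>carrier L. \<forall>b\<in>carrier L. f (a \<sqinter>\<^bsub>L\<^esub> b) \<sqsubseteq>\<^bsub>M\<^esub> f a \<sqinter>\<^bsub>M\<^esub> f b)"

definition antitone_dual_join_morphism ::
    "('a, 'c) gorder_scheme \<Rightarrow> ('b, 'd) gorder_scheme \<Rightarrow> ('a \<Rightarrow> 'b) \<Rightarrow> bool" where
  "antitone_dual_join_morphism L M f \<longleftrightarrow>
     f \<in> carrier L \<rightarrow> carrier M \<and> antitone L M f \<and> dual_join_pres L M f \<and>
     (\<forall>a\<in>carrier L. \<forall>b\<in>carrier L. f a \<squnion>\<^bsub>M\<^esub> f b \<sqsubseteq>\<^bsub>M\<^esub> f (a \<sqinter>\<^bsub>L\<^esub> b))"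


section \<open>The diagram\<close>

text \<open>The eight objects are formal nodes rather than the families of sets they denote: distinct
  nodes may denote the same family (for instance when \<open>K = polar K\<close> or when all faces are
  exposed), and identifying them would create unintended parallel arrows.\<close>

datatype side = Primal | Dual

fun opp :: "side \<Rightarrow> side" where
  "opp Primal = Dual"
| "opp Dual = Primal"

fun body :: "'a::euclidean_space set \<Rightarrow> side \<Rightarrow> 'a set" where
  "body K Primal = K"
| "body K Dual = polar K"

datatype kind = Faces | Exposed | Touching | Normal

fun diagram_obj :: "'a::euclidean_space set \<Rightarrow> kind \<times> side \<Rightarrow> 'a set set" where
  "diagram_obj K (Faces, s) = faces (body K s)"
| "diagram_obj K (Exposed, s) = exposed_faces (body K s)"
| "diagram_obj K (Touching, s) = touching_cones (body K s)"
| "diagram_obj K (Normal, s) = normal_cones (body K s)"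

inductive diagram_arrow ::
    "'a::euclidean_space set \<Rightarrow> kind \<times> side \<Rightarrow> ('a set \<Rightarrow> 'a set) \<Rightarrow> kind \<times> side \<Rightarrow> bool"
  for K where
  cl_normal: "diagram_arrow K (Touching, s) (cl_normal (body K s)) (Normal, s)"
| Phi: "diagram_arrow K (Touching, s) (Phi (body K s)) (Exposed, s)"
| cl_exposed: "diagram_arrow K (Faces, s) (cl_exposed (body K s)) (Exposed, s)"
| Psi: "diagram_arrow K (Faces, s) (Psi (body K s)) (Normal, s)"
| conj: "diagram_arrow K (Faces, s) (conj_face (body K s)) (Exposed, opp s)"
| pos_faces: "diagram_arrow K (Faces, s) pos (Touching, opp s)"
| pos_exposed: "diagram_arrow K (Exposed, s) pos (Normal, opp s)"
| Phi_normal: "diagram_arrow K (Normal, s) (Phi (body K s)) (Exposed, s)"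
| Psi_exposed: "diagram_arrow K (Exposed, s) (Psi (body K s)) (Normal, s)"
| conj_exposed: "diagram_arrow K (Exposed, s) (conj_face (body K s)) (Exposed, opp s)"

inductive diagram_path ::
    "'a::euclidean_space set \<Rightarrow> kind \<times> side \<Rightarrow> ('a set \<Rightarrow> 'a set) \<Rightarrow> kind \<times> side \<Rightarrow> bool"
  for K where
  single: "diagram_arrow K v f w \<Longrightarrow> diagram_path K v f w"
| snoc: "diagram_path K v f w \<Longrightarrow> diagram_arrow K w g x \<Longrightarrow> diagram_path K v (g \<circ> f) x"

definition diagram_well_defined :: "'a::euclidean_space set \<Rightarrow> bool" where
  "diagram_well_defined K \<longleftrightarrow>
     (\<forall>s. Phi_indep (body K s) \<and> Psi_indep (body K s)) \<and>
     (\<forall>v f w. diagram_arrow K v f w \<longrightarrow> f \<in> diagram_obj K v \<rightarrow> diagram_obj K w)"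

definition diagram_commutes :: "'a::euclidean_space set \<Rightarrow> bool" where
  "diagram_commutes K \<longleftrightarrow>
     (\<forall>v w f g. diagram_path K v f w \<longrightarrow> diagram_path K v g w \<longrightarrow>
        (\<forall>A\<in>diagram_obj K v. f A = g A))"

end

theory Submission
  imports Defs
begin

text \<open>
  Write \<open>L\<close> for the polar of \<open>K\<close> and \<open>C\<^sub>K\<close>, \<open>C\<^sub>L\<close> for the two conjugate face maps. Everything comes
  from two observations about the pair.

  First, \<open>C\<^sub>K\<close> and \<open>C\<^sub>L\<close> form an antitone Galois connection between subsets of \<open>K\<close> and of \<open>L\<close>, and
  its closed sets are exactly the exposed faces: a linear functional \<open>x\<close> with maximum \<open>b > 0\<close> on \<open>L\<close>
  can be scaled to maximum \<open>1\<close>, and then \<open>x\<close> is a point of \<open>K\<close>. Hence the closure \<open>cl_exposed\<close> is the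
  composition of the two conjugations (\<open>exposed_faces_eq_conj_face\<close>, \<open>cl_exposed_eq\<close>).

  Second, a proper face of \<open>L\<close> lies in a hyperplane that misses the origin, so taking positive hulls
  loses no information on faces. It is an order isomorphism from the faces of \<open>L\<close> onto the
  touching cones of \<open>K\<close>, and from the exposed faces of \<open>L\<close> onto the normal cones of \<open>K\<close> (\<open>pos_subset_iff\<close>,
  \<open>touching_cones_eq\<close>, \<open>normal_cones_eq\<close>). The normal cone at \<open>x\<close> is the positive hull of
  \<open>C\<^sub>K {x}\<close>.

  Read through this isomorphism, all maps are conjugations: \<open>Psi K F\<close> is \<open>pos (C\<^sub>K F)\<close>,
  \<open>Phi K (pos G)\<close> is \<open>C\<^sub>L G\<close>, and \<open>cl_normal K (pos G)\<close> is \<open>pos (cl_exposed L G)\<close>. The independence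
  of the choice of a relative interior point is the fact that a linear functional which attains its
  maximum over a convex set at a relative interior point is constant there.

  The lattice claims then need no further geometry. Each closure is left adjoint to an inclusion,
  and \<open>Phi\<close>, \<open>Psi\<close> and the conjugations are halves of antitone Galois connections; such maps preserve
  joins (or turn them into meets), and are isomorphisms between the closed elements.

  For commutativity, every object of the diagram carries a map to the exposed faces of \<open>K\<close> that is
  invariant under all arrows. It is injective on exposed faces and on normal cones, so parallel paths
  ending there agree; no path ends in faces, and a path that ends in touching cones is the single
  arrow \<open>pos\<close>.
\<close>

section \<open>Lattices of sets and adjoint maps\<close>

lemma carrier_incl [simp]: "carrier (incl A) = A"
  and le_incl [simp]: "x \<sqsubseteq>\<^bsub>incl A\<^esub> y \<longleftrightarrow> x \<subseteq> y"
  by (simp_all add: incl_def)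

lemma partial_order_incl: "partial_order (incl A)"
  by unfold_locales (auto simp: incl_def)

lemma lattice_inclI:
  assumes "\<And>x y. x \<in> A \<Longrightarrow> y \<in> A \<Longrightarrow>
             \<exists>s\<in>A. x \<subseteq> s \<and> y \<subseteq> s \<and> (\<forall>z\<in>A. x \<subseteq> z \<longrightarrow> y \<subseteq> z \<longrightarrow> s \<subseteq> z)"
    and "\<And>x y. x \<in> A \<Longrightarrow> y \<in> A \<Longrightarrow>
             \<exists>i\<in>A. i \<subseteq> x \<and> i \<subseteq> y \<and> (\<forall>z\<in>A. z \<subseteq> x \<longrightarrow> z \<subseteq> y \<longrightarrow> z \<subseteq> i)"
  shows "lattice (incl A)"
proof -
  interpret partial_order "incl A" by (rule partial_order_incl)
  show ?thesis
  proof
    fix x y assume xy: "x \<in> carrier (incl A)" "y \<in> carrier (incl A)"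
    obtain s where "s \<in> A" "x \<subseteq> s" "y \<subseteq> s" "\<And>z. z \<in> A \<Longrightarrow> x \<subseteq> z \<Longrightarrow> y \<subseteq> z \<Longrightarrow> s \<subseteq> z"
      using assms(1)[of x y] xy by auto
    then have "least (incl A) s (Upper (incl A) {x, y})"
      using xy by (auto simp: least_def Upper_def)
    then show "\<exists>s. least (incl A) s (Upper (incl A) {x, y})" ..
    obtain i where "i \<in> A" "i \<subseteq> x" "i \<subseteq> y" "\<And>z. z \<in> A \<Longrightarrow> z \<subseteq> x \<Longrightarrow> z \<subseteq> y \<Longrightarrow> z \<subseteq> i"
      using assms(2)[of x y] xy by auto
    then have "greatest (incl A) i (Lower (incl A) {x, y})"
      using xy by (auto simp: greatest_def Lower_def)
    then show "\<exists>i. greatest (incl A) i (Lower (incl A) {x, y})" ..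
  qed
qed

text \<open>The join of two members is the intersection of all members above both; the top member
  ensures that there is one.\<close>

lemma lattice_incl_Inter_closed:
  assumes top: "U \<in> A" "\<And>x. x \<in> A \<Longrightarrow> x \<subseteq> U"
    and Inter: "\<And>B. B \<subseteq> A \<Longrightarrow> B \<noteq> {} \<Longrightarrow> \<Inter>B \<in> A"
  shows "lattice (incl A)"
proof (rule lattice_inclI)
  fix x y assume xy: "x \<in> A" "y \<in> A"
  define B where "B = {z \<in> A. x \<subseteq> z \<and> y \<subseteq> z}"
  have "U \<in> B" using top xy by (simp add: B_def)
  then have "\<Inter>B \<in> A" by (intro Inter) (auto simp: B_def)
  moreover have "x \<subseteq> \<Inter>B" "y \<subseteq> \<Inter>B" "\<forall>z\<in>A. x \<subseteq> z \<longrightarrow> y \<subseteq> z \<longrightarrow> \<Inter>B \<subseteq> z"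
    by (auto simp: B_def)
  ultimately show "\<exists>s\<in>A. x \<subseteq> s \<and> y \<subseteq> s \<and> (\<forall>z\<in>A. x \<subseteq> z \<longrightarrow> y \<subseteq> z \<longrightarrow> s \<subseteq> z)"
    by blast
  have "x \<inter> y \<in> A" using Inter[of "{x, y}"] xy by simp
  then show "\<exists>i\<in>A. i \<subseteq> x \<and> i \<subseteq> y \<and> (\<forall>z\<in>A. z \<subseteq> x \<longrightarrow> z \<subseteq> y \<longrightarrow> z \<subseteq> i)"
    by blast
qed

lemma lattice_incl_image:
  assumes "lattice (incl A)"
    and emb: "\<And>x y. x \<in> A \<Longrightarrow> y \<in> A \<Longrightarrow> h x \<subseteq> h y \<longleftrightarrow> x \<subseteq> y"
  shows "lattice (incl (h ` A))"
proof -
  interpret A: lattice "incl A" by (rule assms(1))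
  show ?thesis
  proof (rule lattice_inclI)
    fix x y assume "x \<in> h ` A" "y \<in> h ` A"
    then obtain a b where ab: "a \<in> A" "x = h a" "b \<in> A" "y = h b" by blast
    let ?j = "a \<squnion>\<^bsub>incl A\<^esub> b" and ?m = "a \<sqinter>\<^bsub>incl A\<^esub> b"
    have "?j \<in> A" "a \<subseteq> ?j" "b \<subseteq> ?j" "\<And>c. c \<in> A \<Longrightarrow> a \<subseteq> c \<Longrightarrow> b \<subseteq> c \<Longrightarrow> ?j \<subseteq> c"
      using ab A.join_closed[of a b] A.join_left[of a b] A.join_right[of a b] A.join_le[of a _ b]
      by auto
    then show "\<exists>s\<in>h ` A. x \<subseteq> s \<and> y \<subseteq> s \<and> (\<forall>z\<in>h ` A. x \<subseteq> z \<longrightarrow> y \<subseteq> z \<longrightarrow> s \<subseteq> z)"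
      using ab by (intro bexI[of _ "h ?j"]) (auto simp: emb)
    have "?m \<in> A" "?m \<subseteq> a" "?m \<subseteq> b" "\<And>c. c \<in> A \<Longrightarrow> c \<subseteq> a \<Longrightarrow> c \<subseteq> b \<Longrightarrow> c \<subseteq> ?m"
      using ab A.meet_closed[of a b] A.meet_left[of a b] A.meet_right[of a b] A.meet_le[of _ a b]
      by auto
    then show "\<exists>i\<in>h ` A. i \<subseteq> x \<and> i \<subseteq> y \<and> (\<forall>z\<in>h ` A. z \<subseteq> x \<longrightarrow> z \<subseteq> y \<longrightarrow> z \<subseteq> i)"
      using ab by (intro bexI[of _ "h ?m"]) (auto simp: emb)
  qed
qed

text \<open>Both inequalities between \<open>f (x \<squnion> y)\<close> and \<open>f x \<squnion> f y\<close> are formal: one is monotonicity of \<open>f\<close>,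
  and the other, transposed, says that \<open>g (f x \<squnion> f y)\<close> is an upper bound of \<open>x\<close> and \<open>y\<close>.\<close>

lemma left_adjoint_join_pres:
  assumes L: "lattice L" and M: "lattice M"
    and f: "f \<in> carrier L \<rightarrow> carrier M" and g: "g \<in> carrier M \<rightarrow> carrier L"
    and adj: "\<And>x y. x \<in> carrier L \<Longrightarrow> y \<in> carrier M \<Longrightarrow> f x \<sqsubseteq>\<^bsub>M\<^esub> y \<longleftrightarrow> x \<sqsubseteq>\<^bsub>L\<^esub> g y"
  shows "join_pres L M f"
proof -
  interpret L: lattice L by (rule L)
  interpret M: lattice M by (rule M)
  have gf: "x \<sqsubseteq>\<^bsub>L\<^esub> g (f x)" if "x \<in> carrier L" for x
    using adj[of x "f x"] that f by auto
  have mono: "f x \<sqsubseteq>\<^bsub>M\<^esub> f y" if "x \<in> carrier L" "y \<in> carrier L" "x \<sqsubseteq>\<^bsub>L\<^esub> y" for x y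
  proof -
    have c: "f y \<in> carrier M" "g (f y) \<in> carrier L" using that f g by auto
    then have "x \<sqsubseteq>\<^bsub>L\<^esub> g (f y)" using that gf L.le_trans by blast
    then show ?thesis using adj that c by blast
  qed
  have "f (x \<squnion>\<^bsub>L\<^esub> y) = f x \<squnion>\<^bsub>M\<^esub> f y" if xy: "x \<in> carrier L" "y \<in> carrier L" for x y
  proof -
    let ?j = "f x \<squnion>\<^bsub>M\<^esub> f y"
    have c1: "f x \<in> carrier M" "f y \<in> carrier M" "x \<squnion>\<^bsub>L\<^esub> y \<in> carrier L"
      using xy f by auto
    then have c2: "?j \<in> carrier M" by simp
    have "g ?j \<in> carrier L" "f (x \<squnion>\<^bsub>L\<^esub> y) \<in> carrier M"
      using funcset_mem[OF g c2] funcset_mem[OF f c1(3)] .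
    note c = c1 c2 this
    have "x \<sqsubseteq>\<^bsub>L\<^esub> g ?j" "y \<sqsubseteq>\<^bsub>L\<^esub> g ?j"
      using adj[of _ ?j] xy c M.join_left[of "f x" "f y"] M.join_right[of "f x" "f y"] by auto
    then have "f (x \<squnion>\<^bsub>L\<^esub> y) \<sqsubseteq>\<^bsub>M\<^esub> ?j"
      using adj[of "x \<squnion>\<^bsub>L\<^esub> y" ?j] c xy L.join_le[of x "g ?j" y] by auto
    moreover have "?j \<sqsubseteq>\<^bsub>M\<^esub> f (x \<squnion>\<^bsub>L\<^esub> y)"
      by (intro M.join_le mono c xy L.join_left L.join_right)
    ultimately show ?thesis
      using M.le_antisym c by blast
  qed
  with L M show ?thesis by (simp add: join_pres_def)
qed

lemma left_adjoint_isotone_join_morphism: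
  assumes L: "lattice L" and M: "lattice M"
    and f: "f \<in> carrier L \<rightarrow> carrier M" and g: "g \<in> carrier M \<rightarrow> carrier L"
    and adj: "\<And>x y. x \<in> carrier L \<Longrightarrow> y \<in> carrier M \<Longrightarrow> f x \<sqsubseteq>\<^bsub>M\<^esub> y \<longleftrightarrow> x \<sqsubseteq>\<^bsub>L\<^esub> g y"
  shows "isotone_join_morphism L M f"
proof -
  interpret L: lattice L by (rule L)
  interpret M: lattice M by (rule M)
  have jp: "join_pres L M f" by (rule left_adjoint_join_pres[OF assms])
  then have iso: "isotone L M f" by (rule join_pres_isotone[OF f])
  have "f (a \<sqinter>\<^bsub>L\<^esub> b) \<sqsubseteq>\<^bsub>M\<^esub> f a \<sqinter>\<^bsub>M\<^esub> f b" if ab: "a \<in> carrier L" "b \<in> carrier L" for a b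
    by (rule M.meet_le) (use ab f L.meet_left L.meet_right iso in \<open>auto intro: use_iso2\<close>)
  with f iso jp show ?thesis by (simp add: isotone_join_morphism_def)
qed

text \<open>Antitone maps are isotone maps into the opposite lattice, so an antitone Galois connection
  is an adjunction there.\<close>

lemma galois_antitone_dual_join_morphism:
  assumes L: "lattice L" and M: "lattice M"
    and f: "f \<in> carrier L \<rightarrow> carrier M" and g: "g \<in> carrier M \<rightarrow> carrier L"
    and adj: "\<And>x y. x \<in> carrier L \<Longrightarrow> y \<in> carrier M \<Longrightarrow> y \<sqsubseteq>\<^bsub>M\<^esub> f x \<longleftrightarrow> x \<sqsubseteq>\<^bsub>L\<^esub> g y"
  shows "antitone_dual_join_morphism L M f"
proof -
  have "isotone_join_morphism L (inv_gorder M) f"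
    by (rule left_adjoint_isotone_join_morphism[OF L lattice.dual_lattice[OF M], where g = g])
      (use f g adj in auto)
  with M show ?thesis
    by (simp add: isotone_join_morphism_def antitone_dual_join_morphism_def antitone_def
        join_pres_def dual_join_pres_def)
qed

text \<open>An order isomorphism is left and right adjoint to its inverse; right adjointness is left
  adjointness for the opposite orders, which exchanges joins and meets.\<close>

lemma order_iso_lattice_iso:
  assumes L: "lattice L" and M: "lattice M"
    and bij: "bij_betw f (carrier L) (carrier M)"
    and emb: "\<And>x y. x \<in> carrier L \<Longrightarrow> y \<in> carrier L \<Longrightarrow> f x \<sqsubseteq>\<^bsub>M\<^esub> f y \<longleftrightarrow> x \<sqsubseteq>\<^bsub>L\<^esub> y"
  shows "lattice_iso L M f"
proof -
  define g where "g = inv_into (carrier L) f"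
  have f: "f \<in> carrier L \<rightarrow> carrier M" and g: "g \<in> carrier M \<rightarrow> carrier L"
    using bij bij_betw_inv_into[OF bij] by (auto simp: g_def dest: bij_betwE)
  have fg: "f (g y) = y" if "y \<in> carrier M" for y
    using bij_betw_inv_into_right[OF bij that] by (simp add: g_def)
  have adj: "f x \<sqsubseteq>\<^bsub>M\<^esub> y \<longleftrightarrow> x \<sqsubseteq>\<^bsub>L\<^esub> g y" "y \<sqsubseteq>\<^bsub>M\<^esub> f x \<longleftrightarrow> g y \<sqsubseteq>\<^bsub>L\<^esub> x"
    if "x \<in> carrier L" "y \<in> carrier M" for x y
    using emb[of x "g y"] emb[of "g y" x] that fg[of y] g by auto
  have "join_pres L M f"
    by (rule left_adjoint_join_pres[OF L M f g adj(1)])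
  moreover have "join_pres (inv_gorder L) (inv_gorder M) f"
    by (rule left_adjoint_join_pres[OF lattice.dual_lattice[OF L] lattice.dual_lattice[OF M], where g = g])
      (use f g adj in auto)
  then have "meet_pres L M f"
    using L M by (simp add: join_pres_def meet_pres_def)
  ultimately show ?thesis using bij by (simp add: lattice_iso_def)
qed

lemma inverse_galois_dual_lattice_iso:
  assumes L: "lattice L" and M: "lattice M"
    and f: "f \<in> carrier L \<rightarrow> carrier M" and g: "g \<in> carrier M \<rightarrow> carrier L"
    and adj: "\<And>x y. x \<in> carrier L \<Longrightarrow> y \<in> carrier M \<Longrightarrow> y \<sqsubseteq>\<^bsub>M\<^esub> f x \<longleftrightarrow> x \<sqsubseteq>\<^bsub>L\<^esub> g y"
    and gf: "\<And>x. x \<in> carrier L \<Longrightarrow> g (f x) = x" and fg: "\<And>y. y \<in> carrier M \<Longrightarrow> f (g y) = y"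
  shows "dual_lattice_iso L M f"
proof -
  have bij: "bij_betw f (carrier L) (carrier M)"
    by (rule bij_betwI[OF f g gf fg])
  have "lattice_iso L (inv_gorder M) f"
  proof (rule order_iso_lattice_iso[OF L lattice.dual_lattice[OF M]])
    show "f x \<sqsubseteq>\<^bsub>inv_gorder M\<^esub> f y \<longleftrightarrow> x \<sqsubseteq>\<^bsub>L\<^esub> y" if "x \<in> carrier L" "y \<in> carrier L" for x y
      using adj[of x "f y"] gf[of y] f that by auto
  qed (use bij in simp)
  with M show ?thesis
    by (simp add: lattice_iso_def dual_lattice_iso_def join_pres_def meet_pres_def
        dual_join_pres_def dual_meet_pres_def)
qed


section \<open>Polar bodies\<close>

lemma convex_polar: "convex (polar K)"
proof -
  have "polar K = (\<Inter>v\<in>K. {u. v \<bullet> u \<le> 1})"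
    by (auto simp: polar_def inner_commute)
  then show ?thesis by (auto intro: convex_INT convex_halfspace_le)
qed

text \<open>If \<open>K\<close> lies in the ball of radius \<open>B\<close>, then its polar contains the ball of radius \<open>1 / B\<close>.\<close>

lemma zero_interior_polar:
  fixes K :: "'a::euclidean_space set"
  assumes "bounded K"
  shows "0 \<in> interior (polar K)"
proof -
  obtain B where B: "0 < B" "\<And>v. v \<in> K \<Longrightarrow> norm v \<le> B"
    using assms by (auto simp: bounded_pos)
  have "u \<bullet> v \<le> 1" if "norm u < 1 / B" "v \<in> K" for u v
  proof -
    have "u \<bullet> v \<le> norm u * norm v" by (rule norm_cauchy_schwarz)
    also have "\<dots> \<le> (1 / B) * B" using that B by (intro mult_mono) auto
    finally show ?thesis using B by simp
  qed
  then have "ball 0 (1 / B) \<subseteq> polar K" by (auto simp: polar_def)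
  moreover have "0 < 1 / B" using B by simp
  ultimately show ?thesis unfolding mem_interior by blast
qed

text \<open>The bipolar theorem: a hyperplane that separates a point strictly from \<open>K\<close> misses the origin,
  and its normal vector, scaled to put the hyperplane at level \<open>1\<close>, is an element of the polar.\<close>

lemma polar_polar:
  fixes K :: "'a::euclidean_space set"
  assumes "closed K" "convex K" "0 \<in> K"
  shows "polar (polar K) = K"
proof (intro equalityI subsetI)
  fix x assume x: "x \<in> polar (polar K)"
  show "x \<in> K"
  proof (rule ccontr)
    assume "x \<notin> K"
    then obtain a b where ab: "a \<bullet> x < b" "\<And>y. y \<in> K \<Longrightarrow> b < a \<bullet> y"
      using separating_hyperplane_closed_point[OF assms(2,1)] by blast
    have b: "b < 0" using ab(2)[OF assms(3)] by simp
    have "(1 / b) *\<^sub>R a \<in> polar K"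
      using ab(2) b by (auto simp: polar_def field_simps intro: less_imp_le)
    then have "x \<bullet> ((1 / b) *\<^sub>R a) \<le> 1" using x unfolding polar_def by blast
    then show False using ab(1) b by (simp add: field_simps inner_commute)
  qed
qed (auto simp: polar_def inner_commute)

text \<open>The assumptions make both sets compact and convex: each is the polar of a neighbourhood of \<open>0\<close>.\<close>

locale polar_pair =
  fixes K L :: "'a::euclidean_space set"
  assumes zero_interior: "0 \<in> interior K" and zero_interior': "0 \<in> interior L"
    and polar: "polar K = L" and polar': "polar L = K"
begin

lemma conv: "convex K" and conv': "convex L"
  using convex_polar[of L] convex_polar[of K] by (simp_all add: polar polar')

text \<open>Polarity is symmetric, so every fact about the pair has a mirror image, available under the
  prefix \<open>swap\<close> wherever the context is opened again.\<close>

sublocale swap: polar_pair L K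
  by unfold_locales (fact zero_interior' zero_interior polar' polar)+

end

lemma polar_pair_polar:
  assumes "compact K" "convex K" "0 \<in> interior K"
  shows "polar_pair K (polar K)"
proof
  show "0 \<in> interior (polar K)"
    using assms by (intro zero_interior_polar compact_imp_bounded)
  show "polar (polar K) = K"
    using assms interior_subset by (intro polar_polar compact_imp_closed) auto
qed (use assms in simp_all)


section \<open>Conjugate faces\<close>

text \<open>The points where the maximum is attained form a face, and a face that meets the relative
  interior is everything. This is what makes \<open>Phi\<close> and \<open>Psi\<close> independent of choices.\<close>

lemma linear_max_rel_interior:
  fixes S :: "'a::euclidean_space set"
  assumes "convex S" "\<And>w. w \<in> S \<Longrightarrow> a \<bullet> w \<le> b" "z \<in> rel_interior S" "a \<bullet> z = b" "w \<in> S"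
  shows "a \<bullet> w = b"
proof -
  have "S \<inter> {w. a \<bullet> w = b} face_of S"
    by (rule face_of_Int_supporting_hyperplane_le[OF assms(1,2)])
  then have "S \<subseteq> S \<inter> {w. a \<bullet> w = b}"
    by (rule subset_of_face_of) (use assms(3,4) rel_interior_subset in auto)
  with assms(5) show ?thesis by blast
qed

context polar_pair
begin

lemma mem_conj_face: "v \<in> conj_face K F \<longleftrightarrow> v \<in> L \<and> (\<forall>u\<in>F. u \<bullet> v = 1)"
  by (auto simp: conj_face_def polar inner_commute)

lemma zero_in: "0 \<in> K"
  using zero_interior interior_subset by auto

lemma inner_le_1: "u \<in> K \<Longrightarrow> v \<in> L \<Longrightarrow> u \<bullet> v \<le> 1"
  unfolding polar'[symmetric] by (simp add: polar_def)

lemma conj_face_subset: "conj_face K F \<subseteq> L"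
  by (auto simp: mem_conj_face)

lemma conj_face_empty [simp]: "conj_face K {} = L"
  by (auto simp: mem_conj_face)

lemma conj_face_self [simp]: "conj_face K K = {}"
  using zero_in by (force simp: mem_conj_face)

end

context polar_pair
begin

lemma conj_face_galois:
  "F \<subseteq> K \<Longrightarrow> G \<subseteq> L \<Longrightarrow> G \<subseteq> conj_face K F \<longleftrightarrow> F \<subseteq> conj_face L G"
  unfolding subset_iff mem_conj_face swap.mem_conj_face by (metis inner_commute)

lemma conj_face_triple:
  assumes "F \<subseteq> K"
  shows "conj_face K (conj_face L (conj_face K F)) = conj_face K F"
proof (intro equalityI)
  have sub: "F \<subseteq> conj_face L (conj_face K F)"
    using conj_face_galois[OF assms conj_face_subset] by blast
  then show "conj_face K (conj_face L (conj_face K F)) \<subseteq> conj_face K F"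
    unfolding conj_face_def[of K] by blast
  show "conj_face K F \<subseteq> conj_face K (conj_face L (conj_face K F))"
    using conj_face_galois[OF swap.conj_face_subset conj_face_subset] by blast
qed

lemma conj_face_rel_interior:
  assumes "F \<subseteq> K" "convex F" "x \<in> rel_interior F"
  shows "conj_face K F = conj_face K {x}"
proof (intro equalityI subsetI)
  fix v assume v: "v \<in> conj_face K {x}"
  have "v \<bullet> u = 1" if "u \<in> F" for u
    by (rule linear_max_rel_interior[OF assms(2) _ assms(3) _ that])
      (use v assms(1) inner_le_1 in \<open>auto simp: mem_conj_face inner_commute\<close>)
  with v show "v \<in> conj_face K F" by (auto simp: mem_conj_face inner_commute)
qed (use assms(3) rel_interior_subset in \<open>auto simp: mem_conj_face\<close>)

lemma conj_face_singleton_exposed: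
  assumes "x \<in> K"
  shows "conj_face K {x} \<in> exposed_faces L"
proof -
  have "conj_face K {x} = L \<inter> {v. x \<bullet> v = 1}" by (auto simp: mem_conj_face)
  then show ?thesis
    using exposed_face_of_Int_supporting_hyperplane_le[OF conv', of x 1] inner_le_1[OF assms]
    by (simp add: exposed_faces_def)
qed

text \<open>Scale a supporting functional of \<open>L\<close> to level \<open>1\<close>; it then belongs to the polar of \<open>L\<close>, which
  is \<open>K\<close>. Level \<open>0\<close> forces the functional to vanish, as \<open>0\<close> is interior to \<open>L\<close>, and gives \<open>L\<close> itself.
  The empty exposed face arises from an \<open>x\<close> that does not reach level \<open>1\<close>, for instance \<open>0\<close>.\<close>

lemma exposed_faces_eq_conj_face:
  "exposed_faces L = insert L ((\<lambda>x. conj_face K {x}) ` K)"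
proof (intro equalityI subsetI)
  fix E assume "E \<in> exposed_faces L"
  then obtain a b where ab: "L \<subseteq> {x. a \<bullet> x \<le> b}" "E = L \<inter> {x. a \<bullet> x = b}"
    unfolding exposed_faces_def exposed_face_of_def by blast
  have "0 \<le> b" using ab(1) swap.zero_in by auto
  show "E \<in> insert L ((\<lambda>x. conj_face K {x}) ` K)"
  proof (cases "b = 0")
    case True
    have "a = 0"
    proof (rule ccontr)
      assume "a \<noteq> 0"
      obtain e where e: "0 < e" "cball 0 e \<subseteq> L"
        using zero_interior' by (auto simp: mem_interior_cball)
      have "(e / norm a) *\<^sub>R a \<in> L" using e \<open>a \<noteq> 0\<close> by (intro subsetD[OF e(2)]) simp
      then have "a \<bullet> ((e / norm a) *\<^sub>R a) \<le> 0" using ab(1) True by blast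
      then show False using e \<open>a \<noteq> 0\<close> by (simp add: field_simps mult_le_0_iff flip: not_less)
    qed
    then show ?thesis using ab True by auto
  next
    case False
    then have b: "0 < b" using \<open>0 \<le> b\<close> by simp
    have "(1 / b) *\<^sub>R a \<in> K"
      unfolding polar'[symmetric] polar_def using ab(1) b by (auto simp: field_simps)
    moreover have "E = conj_face K {(1 / b) *\<^sub>R a}"
      using ab(2) b by (auto simp: mem_conj_face field_simps)
    ultimately show ?thesis by blast
  qed
qed (use conj_face_singleton_exposed conv' in \<open>auto simp: exposed_faces_def\<close>)

text \<open>The exposed faces \<open>conj_face K {u}\<close>, for \<open>u\<close> in a nonempty set \<open>F\<close>, intersect in one of the
  same form: replace \<open>F\<close> by a relative interior point of its convex hull.\<close>

lemma conj_face_exposed: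
  assumes "F \<subseteq> K"
  shows "conj_face K F \<in> exposed_faces L"
proof (cases "F = {}")
  case False
  have hull: "conj_face K (convex hull F) = conj_face K F"
  proof (intro equalityI subsetI)
    fix v assume v: "v \<in> conj_face K F"
    have "convex {u. v \<bullet> u = 1}" by (rule convex_hyperplane)
    then have "convex hull F \<subseteq> {u. v \<bullet> u = 1}"
      using v by (intro hull_minimal) (auto simp: mem_conj_face inner_commute)
    then show "v \<in> conj_face K (convex hull F)"
      using v by (auto simp: mem_conj_face inner_commute)
  qed (auto simp: mem_conj_face hull_inc)
  have sub: "convex hull F \<subseteq> K" using assms conv by (intro hull_minimal)
  have "rel_interior (convex hull F) \<noteq> {}"
    using False by (simp add: rel_interior_eq_empty convex_convex_hull)
  then obtain x where "x \<in> rel_interior (convex hull F)" by blast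
  then have "conj_face K F = conj_face K {x}" "x \<in> K"
    using conj_face_rel_interior[OF sub convex_convex_hull] hull sub rel_interior_subset by blast+
  then show ?thesis using conj_face_singleton_exposed by simp
qed (use conv' in \<open>simp add: exposed_faces_def\<close>)

lemma exposed_imp_face: "E \<in> exposed_faces L \<Longrightarrow> E \<in> faces L"
  by (simp add: exposed_faces_def faces_def exposed_face_of_def)

lemma face_subset: "F \<in> faces K \<Longrightarrow> F \<subseteq> K"
  by (auto simp: faces_def dest: face_of_imp_subset)

lemma face_convex: "F \<in> faces K \<Longrightarrow> convex F"
  by (auto simp: faces_def dest: face_of_imp_convex)

end

context polar_pair
begin

lemma exposed_subset: "E \<in> exposed_faces L \<Longrightarrow> E \<subseteq> L"
  using exposed_imp_face swap.face_subset by blast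

lemma conj_face_conj_face:
  assumes "E \<in> exposed_faces L"
  shows "conj_face K (conj_face L E) = E"
proof -
  obtain F where "F \<subseteq> K" "E = conj_face K F"
    using assms conj_face_empty unfolding exposed_faces_eq_conj_face
    by (elim insertE imageE) blast+
  then show ?thesis by (simp only: conj_face_triple)
qed

end

context polar_pair
begin

lemma cl_exposed_eq:
  assumes "G \<subseteq> L"
  shows "cl_exposed L G = conj_face K (conj_face L G)"
proof (intro equalityI)
  have "conj_face K (conj_face L G) \<in> exposed_faces L" "G \<subseteq> conj_face K (conj_face L G)"
    using conj_face_exposed[OF swap.conj_face_subset]
      conj_face_galois[OF swap.conj_face_subset assms] by blast+
  then show "cl_exposed L G \<subseteq> conj_face K (conj_face L G)"
    by (auto simp: cl_exposed_def)
  have "conj_face K (conj_face L G) \<subseteq> E" if E: "E \<in> exposed_faces L" "G \<subseteq> E" for E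
  proof -
    have "conj_face L E \<subseteq> conj_face L G" using E(2) unfolding conj_face_def by blast
    then have "conj_face K (conj_face L G) \<subseteq> conj_face K (conj_face L E)"
      unfolding conj_face_def by blast
    with conj_face_conj_face[OF E(1)] show ?thesis by simp
  qed
  then show "conj_face K (conj_face L G) \<subseteq> cl_exposed L G"
    by (auto simp: cl_exposed_def)
qed

lemma cl_exposed_in: "G \<subseteq> L \<Longrightarrow> cl_exposed L G \<in> exposed_faces L"
  by (simp add: cl_exposed_eq conj_face_exposed swap.conj_face_subset)

lemma cl_exposed_exposed: "E \<in> exposed_faces L \<Longrightarrow> cl_exposed L E = E"
  by (simp add: cl_exposed_eq exposed_subset conj_face_conj_face)

lemma cl_exposed_subset_iff:
  "G \<subseteq> L \<Longrightarrow> E \<in> exposed_faces L \<Longrightarrow> cl_exposed L G \<subseteq> E \<longleftrightarrow> G \<subseteq> E"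
  by (auto simp: cl_exposed_def)

end

context polar_pair
begin

lemma conj_face_cl_exposed: "F \<subseteq> K \<Longrightarrow> conj_face K (cl_exposed K F) = conj_face K F"
  by (simp add: swap.cl_exposed_eq conj_face_triple)

text \<open>A hyperplane that supports \<open>L\<close> at a relative interior point of \<open>F\<close> contains all of \<open>F\<close>.
  It misses the interior point \<open>0\<close>, so it can be put at level \<open>1\<close>.\<close>

lemma face_subset_conj_face:
  assumes "F \<in> faces L" "F \<noteq> L"
  shows "\<exists>x\<in>K. F \<subseteq> conj_face K {x}"
proof (cases "F = {}")
  case False
  have F: "F face_of L" "F \<subseteq> L" "convex F"
    using assms(1) swap.face_subset[OF assms(1)] swap.face_convex[OF assms(1)]
    by (simp_all add: faces_def)
  obtain g where g: "g \<in> rel_interior F"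
    using False F(3) rel_interior_eq_empty by blast
  then have "g \<in> F" using rel_interior_subset by blast
  then have "g \<in> L" "g \<notin> rel_interior L"
    using F assms(2) face_of_disjoint_rel_interior by blast+
  then obtain a where "a \<noteq> 0" and a: "\<And>y. y \<in> L \<Longrightarrow> a \<bullet> g \<le> a \<bullet> y"
      "\<And>y. y \<in> rel_interior L \<Longrightarrow> a \<bullet> g < a \<bullet> y"
    by (rule supporting_hyperplane_rel_boundary[OF conv']) blast
  define b where "b = - (a \<bullet> g)"
  have b: "0 < b"
    using a(2)[of 0] subsetD[OF interior_subset_rel_interior zero_interior'] by (simp add: b_def)
  define x where "x = (- 1 / b) *\<^sub>R a"
  have le: "x \<bullet> y \<le> 1" if "y \<in> L" for y
    using a(1)[OF that] b by (simp add: x_def field_simps b_def)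
  then have "x \<in> K" unfolding polar'[symmetric] by (simp add: polar_def)
  moreover have "x \<bullet> g = 1" using b by (simp add: x_def b_def)
  then have "x \<bullet> w = 1" if "w \<in> F" for w
    using linear_max_rel_interior[OF F(3) _ g _ that] le F(2) by blast
  then have "F \<subseteq> conj_face K {x}" using F(2) by (auto simp: mem_conj_face)
  ultimately show ?thesis by blast
qed (use zero_in in auto)

end


section \<open>Positive hulls and cones\<close>

text \<open>This form makes no case distinction for the empty set, where the value \<open>{0}\<close> is a convention.\<close>

lemma mem_pos: "v \<in> pos X \<longleftrightarrow> v = 0 \<or> (\<exists>c>0. \<exists>x\<in>X. v = c *\<^sub>R x)"
proof (cases "X = {}")
  case False
  then have "v \<in> pos X \<longleftrightarrow> (\<exists>c\<ge>0. \<exists>x\<in>X. v = c *\<^sub>R x)"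
    by (auto simp: pos_def)
  also have "\<dots> \<longleftrightarrow> v = 0 \<or> (\<exists>c>0. \<exists>x\<in>X. v = c *\<^sub>R x)"
  proof
    assume "\<exists>c\<ge>0. \<exists>x\<in>X. v = c *\<^sub>R x"
    then obtain c x where "0 \<le> c" "x \<in> X" "v = c *\<^sub>R x" by blast
    then show "v = 0 \<or> (\<exists>c>0. \<exists>x\<in>X. v = c *\<^sub>R x)" by (cases "c = 0") (auto intro!: exI[of _ c])
  next
    assume "v = 0 \<or> (\<exists>c>0. \<exists>x\<in>X. v = c *\<^sub>R x)"
    then show "\<exists>c\<ge>0. \<exists>x\<in>X. v = c *\<^sub>R x"
    proof
      assume "v = 0"
      then show ?thesis using False by (intro exI[of _ 0]) auto
    qed (auto intro: less_imp_le)
  qed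
  finally show ?thesis .
qed (simp add: pos_def)

lemma zero_in_pos [simp]: "0 \<in> pos X"
  and pos_ne_empty [simp]: "pos X \<noteq> {}"
  using mem_pos by blast+

lemma scaleR_in_pos: "0 \<le> c \<Longrightarrow> v \<in> pos X \<Longrightarrow> c *\<^sub>R v \<in> pos X"
  unfolding mem_pos by (cases "c = 0") (auto, metis less_eq_real_def mult_pos_pos)

lemma subset_pos: "X \<subseteq> pos X"
  by (force simp: mem_pos intro: exI[of _ 1])

lemma pos_mono: "X \<subseteq> Y \<Longrightarrow> pos X \<subseteq> pos Y"
  unfolding subset_iff mem_pos by blast

lemma convex_pos:
  assumes "convex X"
  shows "convex (pos X)"
proof (cases "X = {}")
  case False
  then have "pos X = cone hull X" by (auto simp: pos_def cone_hull_expl)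
  then show ?thesis using convex_cone_hull[OF assms] by simp
qed (simp add: pos_def)

lemma pos_eq_UNIV:
  fixes X :: "'a::euclidean_space set"
  assumes "0 \<in> interior X"
  shows "pos X = UNIV"
proof -
  obtain e where e: "0 < e" "cball 0 e \<subseteq> X"
    using assms by (auto simp: mem_interior_cball)
  have "v \<in> pos X" for v
  proof (cases "v = 0")
    case False
    then have "(e / norm v) *\<^sub>R v \<in> pos X"
      using e by (intro subsetD[OF subset_pos] subsetD[OF e(2)]) simp
    then have "(norm v / e) *\<^sub>R (e / norm v) *\<^sub>R v \<in> pos X"
      by (rule scaleR_in_pos[rotated]) (use e in simp)
    then show ?thesis using e False by simp
  qed simp
  then show ?thesis by blast
qed

text \<open>The functional \<open>x\<close> measures how far a point of the cone has been stretched. Suppose that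
  \<open>w = (1 - t) a + t b\<close> lies on the ray through \<open>g \<in> G\<close>. Rescaling \<open>w\<close>, \<open>a\<close>, \<open>b\<close> to level \<open>1\<close> turns this into
  a convex combination \<open>g = (1 - s) e + s f\<close> in \<open>E\<close>, with a new parameter \<open>s\<close>, to which the face property of
  \<open>G\<close> applies. Only the apex \<open>0\<close> cannot be rescaled.\<close>

lemma pos_face_of:
  fixes x :: "'a::euclidean_space"
  assumes G: "G face_of E" and E: "\<And>v. v \<in> E \<Longrightarrow> x \<bullet> v = 1"
  shows "pos G face_of pos E"
  unfolding face_of_def
proof (intro conjI ballI impI)
  show "pos G \<subseteq> pos E" by (rule pos_mono[OF face_of_imp_subset[OF G]])
  show "convex (pos G)" by (rule convex_pos[OF face_of_imp_convex[OF G]])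
  have *: "a \<in> pos G"
    if ab: "a \<in> pos E" "b \<in> pos E" and w: "w \<in> pos G" "w \<in> open_segment a b" for a b w
  proof (cases "a = 0")
    case False
    then obtain \<alpha> e where a: "0 < \<alpha>" "e \<in> E" "a = \<alpha> *\<^sub>R e" using ab(1) by (auto simp: mem_pos)
    obtain t where t: "a \<noteq> b" "0 < t" "t < 1" "w = (1 - t) *\<^sub>R a + t *\<^sub>R b"
      using w(2) by (auto simp: in_segment)
    have xb: "0 \<le> x \<bullet> b" using ab(2) E by (auto simp: mem_pos)
    have "x \<bullet> w = (1 - t) * \<alpha> + t * (x \<bullet> b)" using t a E by (simp add: inner_add_right)
    moreover have "0 < (1 - t) * \<alpha>" using t a by simp
    ultimately have xw: "0 < x \<bullet> w" using t xb by (simp add: add_pos_nonneg)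
    then obtain \<gamma> g where g: "0 < \<gamma>" "g \<in> G" "w = \<gamma> *\<^sub>R g" using w(1) by (auto simp: mem_pos)
    have gE: "g \<in> E" using g face_of_imp_subset[OF G] by blast
    have "e \<in> G"
    proof (cases "b = 0")
      case True
      have \<gamma>: "\<gamma> = (1 - t) * \<alpha>"
        using arg_cong[OF t(4), of "\<lambda>v. x \<bullet> v"] True g a E gE by simp
      have "\<gamma> *\<^sub>R g = \<gamma> *\<^sub>R e" using t(4) True g a by (simp add: \<gamma>)
      then have "g = e" using g(1) by (metis less_irrefl scaleR_left_imp_eq)
      with g show ?thesis by simp
    next
      case False
      then obtain \<beta> f where b: "0 < \<beta>" "f \<in> E" "b = \<beta> *\<^sub>R f" using ab(2) by (auto simp: mem_pos)
      have \<gamma>: "\<gamma> = (1 - t) * \<alpha> + t * \<beta>"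
        using arg_cong[OF t(4), of "\<lambda>v. x \<bullet> v"] g a b E gE by (simp add: inner_add_right)
      define s where "s = t * \<beta> / \<gamma>"
      have s: "0 < s" "s < 1" "1 - s = (1 - t) * \<alpha> / \<gamma>"
        using g(1) t a b by (auto simp: s_def field_simps \<gamma>)
      have "\<gamma> *\<^sub>R g = ((1 - t) * \<alpha>) *\<^sub>R e + (t * \<beta>) *\<^sub>R f" using t(4) g a b by simp
      then have "(1 / \<gamma>) *\<^sub>R \<gamma> *\<^sub>R g = ((1 - t) * \<alpha> / \<gamma>) *\<^sub>R e + (t * \<beta> / \<gamma>) *\<^sub>R f"
        by (simp add: scaleR_add_right)
      then have "(1 / \<gamma>) *\<^sub>R \<gamma> *\<^sub>R g = (1 - s) *\<^sub>R e + s *\<^sub>R f"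
        unfolding s(3) unfolding s_def .
      then have g_eq: "g = (1 - s) *\<^sub>R e + s *\<^sub>R f" using g(1) by simp
      show ?thesis
      proof (cases "e = f")
        case True
        then have "g = e" using g_eq by (simp flip: scaleR_left_distrib)
        with g show ?thesis by simp
      next
        case False
        then have "g \<in> open_segment e f" using g_eq s by (auto simp: in_segment)
        then show ?thesis using face_ofD[OF G] g(2) a(2) b(2) by blast
      qed
    qed
    then show ?thesis using a by (auto simp: mem_pos)
  qed simp
  fix a b w assume "a \<in> pos E" "b \<in> pos E" "w \<in> pos G" "w \<in> open_segment a b"
  then show "a \<in> pos G" "b \<in> pos G"
    using *[of a b w] *[of b a w] by (simp_all add: open_segment_commute)
qed

text \<open>A nonempty face of a cone is a cone: from \<open>t \<noteq> 0\<close> one gets \<open>0\<close> and \<open>c t\<close> for \<open>c > 1\<close>, because \<open>t\<close>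
  lies strictly between them. So each of its rays meets \<open>E\<close> inside the face.\<close>

lemma face_of_pos:
  assumes T: "T face_of pos E" "T \<noteq> {}"
  shows "T = pos (T \<inter> E)"
proof -
  have up: "c *\<^sub>R t \<in> T" "0 \<in> T" if t: "t \<in> T" "t \<noteq> 0" "1 < c" for c t
  proof -
    have mem: "c *\<^sub>R t \<in> pos E"
      using t face_of_imp_subset[OF T(1)] by (intro scaleR_in_pos) auto
    have "t = (1 - 1 / c) *\<^sub>R 0 + (1 / c) *\<^sub>R (c *\<^sub>R t)" using t by simp
    then have "t \<in> open_segment 0 (c *\<^sub>R t)"
      unfolding in_segment using t by (intro conjI exI[of _ "1 / c"]) auto
    then show "c *\<^sub>R t \<in> T" "0 \<in> T"
      using face_ofD[OF T(1) _ zero_in_pos mem t(1)] by blast+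
  qed
  have zero: "0 \<in> T" using T(2) up(2)[of _ 2] by fastforce
  have cone: "c *\<^sub>R t \<in> T" if "t \<in> T" "0 \<le> c" for c t
  proof (cases "t = 0 \<or> c \<le> 1")
    case True
    have "(1 - c) *\<^sub>R 0 + c *\<^sub>R t \<in> T" if "c \<le> 1"
      using face_of_imp_convex[OF T(1)] zero \<open>t \<in> T\<close> \<open>0 \<le> c\<close> that
      unfolding convex_alt by blast
    with True zero show ?thesis by auto
  qed (use that up in auto)
  show ?thesis
  proof (intro equalityI subsetI)
    fix t assume t: "t \<in> T"
    then consider "t = 0" | c e where "0 < c" "e \<in> E" "t = c *\<^sub>R e"
      using face_of_imp_subset[OF T(1)] by (auto simp: subset_iff mem_pos)
    then show "t \<in> pos (T \<inter> E)"
    proof cases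
      case 2
      then have "e \<in> T" using cone[OF t, of "1 / c"] by simp
      with 2 show ?thesis by (auto simp: mem_pos)
    qed simp
  qed (use zero cone in \<open>auto simp: mem_pos\<close>)
qed

lemma support_fun_eq:
  assumes "x \<in> C" "\<And>y. y \<in> C \<Longrightarrow> y \<bullet> u \<le> x \<bullet> u"
  shows "support_fun C u = x \<bullet> u"
  unfolding support_fun_def by (rule cSup_eq_maximum) (use assms in auto)

context polar_pair
begin

lemma pos_self: "pos L = UNIV"
  by (rule pos_eq_UNIV[OF zero_interior'])

lemma inner_pos:
  assumes "F \<subseteq> conj_face K {x}" "v \<in> pos F" "v \<noteq> 0"
  shows "0 < x \<bullet> v"
  using assms by (auto simp: mem_pos mem_conj_face subset_iff)

text \<open>For a proper face, some \<open>x \<in> K\<close> is a functional that is positive on all of \<open>pos F - {0}\<close>, so this set cannot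
  contain a vector together with its negative.\<close>

lemma pos_face_eq_UNIV_iff:
  assumes "F \<in> faces L"
  shows "pos F = UNIV \<longleftrightarrow> F = L"
proof
  assume U: "pos F = UNIV"
  show "F = L"
  proof (rule ccontr)
    assume "F \<noteq> L"
    then obtain x where x: "F \<subseteq> conj_face K {x}" using face_subset_conj_face[OF assms] by blast
    obtain w :: 'a where "w \<noteq> 0" using nonempty_Basis nonzero_Basis by blast
    then have "0 < x \<bullet> w" "0 < x \<bullet> (- w)" using inner_pos[OF x, of w] inner_pos[OF x, of "- w"] U
      by simp_all
    then show False by simp
  qed
qed (simp add: pos_self)

lemma zero_in_face_iff:
  assumes "F \<in> faces L"
  shows "0 \<in> F \<longleftrightarrow> F = L"
  using face_subset_conj_face[OF assms] swap.zero_in by (force simp: mem_conj_face)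

lemma pos_subset_iff:
  assumes F: "F \<in> faces L" and G: "G \<in> faces L"
  shows "pos F \<subseteq> pos G \<longleftrightarrow> F \<subseteq> G"
proof
  assume sub: "pos F \<subseteq> pos G"
  show "F \<subseteq> G"
  proof (cases "G = L")
    case True
    then show ?thesis using swap.face_subset[OF F] by simp
  next
    case False
    then have "F \<noteq> L" using sub pos_face_eq_UNIV_iff[OF G] by (auto simp: pos_self)
    then have zF: "0 \<notin> F" and zG: "0 \<notin> G"
      using False zero_in_face_iff[OF F] zero_in_face_iff[OF G] by auto
    \<comment> \<open>A ray from the origin cannot meet faces that miss the origin in two different points:
      the inner point would lie between the outer one and \<open>0\<close>.\<close>
    have ray: "c \<le> 1" if H: "H \<in> faces L" "0 \<notin> H" and v: "v \<in> H" "c *\<^sub>R v \<in> L" for H c v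
    proof (rule ccontr)
      assume "\<not> c \<le> 1"
      then have c: "1 < c" by simp
      have "v \<noteq> 0" using v H by auto
      have "v = (1 - 1 / c) *\<^sub>R 0 + (1 / c) *\<^sub>R (c *\<^sub>R v)" using c by simp
      then have "v \<in> open_segment 0 (c *\<^sub>R v)"
        unfolding in_segment using c \<open>v \<noteq> 0\<close> by (intro conjI exI[of _ "1 / c"]) auto
      then show False using H v swap.zero_in face_ofD[of H L v 0 "c *\<^sub>R v"] by (auto simp: faces_def)
    qed
    show ?thesis
    proof
      fix v assume v: "v \<in> F"
      then have "v \<in> pos G" using sub subset_pos by blast
      with v zF obtain c w where w: "0 < c" "w \<in> G" "v = c *\<^sub>R w" by (auto simp: mem_pos)
      have "v \<in> L" "w \<in> L" using v w F G swap.face_subset by blast+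
      then have "c \<le> 1" using ray[OF G zG w(2), of c] w(3) by simp
      moreover have "1 / c \<le> 1" using ray[OF F zF v, of "1 / c"] w \<open>w \<in> L\<close> by simp
      ultimately have "c = 1" using w(1) by (simp add: field_simps)
      with w show "v \<in> G" by simp
    qed
  qed
qed (rule pos_mono)

lemma inj_on_pos: "inj_on pos (faces L)"
  using pos_subset_iff by (intro inj_onI) blast

text \<open>A nonzero normal vector \<open>u\<close> at \<open>x\<close> satisfies \<open>u \<bullet> x > 0\<close>, because a small positive multiple of
  \<open>u\<close> lies in \<open>K\<close>. Dividing \<open>u\<close> by this number yields an element of \<open>L\<close> with value \<open>1\<close> at \<open>x\<close>.\<close>

lemma normal_cone_eq:
  assumes x: "x \<in> K"
  shows "normal_cone K x = pos (conj_face K {x})"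
proof (intro equalityI subsetI)
  fix u assume u: "u \<in> normal_cone K x"
  show "u \<in> pos (conj_face K {x})"
  proof (cases "u = 0")
    case False
    have le: "u \<bullet> y \<le> u \<bullet> x" if "y \<in> K" for y
      using u that by (simp add: normal_cone_def inner_diff_right)
    obtain e where e: "0 < e" "cball 0 e \<subseteq> K"
      using zero_interior by (auto simp: mem_interior_cball)
    have "(e / norm u) *\<^sub>R u \<in> K" using e False by (intro subsetD[OF e(2)]) simp
    then have "u \<bullet> ((e / norm u) *\<^sub>R u) \<le> u \<bullet> x" by (rule le)
    moreover have "0 < u \<bullet> ((e / norm u) *\<^sub>R u)" using e False by simp
    ultimately have h: "0 < u \<bullet> x" by linarith
    define v where "v = (1 / (u \<bullet> x)) *\<^sub>R u"
    have "v \<in> conj_face K {x}"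
      using le h by (simp add: v_def mem_conj_face polar[symmetric] polar_def field_simps inner_commute)
    moreover have "u = (u \<bullet> x) *\<^sub>R v" using h by (simp add: v_def)
    ultimately show ?thesis using h mem_pos by blast
  qed simp
next
  fix u assume "u \<in> pos (conj_face K {x})"
  then consider "u = 0" | c v where "0 < c" "v \<in> conj_face K {x}" "u = c *\<^sub>R v"
    by (auto simp: mem_pos)
  then show "u \<in> normal_cone K x"
  proof cases
    case 2
    have "v \<bullet> y \<le> v \<bullet> x" if "y \<in> K" for y
      using 2(2) inner_le_1[OF that] by (auto simp: mem_conj_face inner_commute)
    with 2 show ?thesis by (simp add: normal_cone_def inner_diff_right mult_le_0_iff)
  qed (simp add: normal_cone_def)
qed

lemma normal_cones_eq: "normal_cones K = pos ` exposed_faces L"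
  by (auto simp: normal_cones_def exposed_faces_eq_conj_face pos_self normal_cone_eq image_image)

text \<open>A nonempty face of \<open>pos E\<close> is the positive hull of its trace on \<open>E\<close>, which is a face of \<open>E\<close>
  and thus of \<open>L\<close>. Conversely a proper face of \<open>L\<close> is a face of an exposed face at level \<open>1\<close>, and
  \<open>pos_face_of\<close> applies. The improper face \<open>L\<close> corresponds to the improper normal cone \<open>UNIV\<close>.\<close>

lemma touching_cones_eq: "touching_cones K = pos ` faces L"
proof (intro equalityI subsetI)
  fix T assume "T \<in> touching_cones K"
  then obtain E where T: "T \<noteq> {}" "T face_of pos E" and E: "E \<in> exposed_faces L"
    by (auto simp: touching_cones_def normal_cones_eq)
  show "T \<in> pos ` faces L"
  proof (cases "E = L")
    case True
    then have "T = pos L"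
      using T face_of_affine_trivial[OF affine_UNIV, of T] by (auto simp: pos_self)
    moreover have "L \<in> faces L" using conv' by (simp add: faces_def face_of_refl)
    ultimately show ?thesis by blast
  next
    case False
    have Ef: "E face_of L" using exposed_imp_face[OF E] by (simp add: faces_def)
    have "(T \<inter> E) face_of (pos E \<inter> E)"
      using T(2) Ef face_of_imp_convex face_of_slice by blast
    moreover have "pos E \<inter> E = E" using subset_pos by blast
    ultimately have "(T \<inter> E) face_of L" using Ef face_of_trans by auto
    with face_of_pos[OF T(2,1)] show ?thesis by (auto simp: faces_def)
  qed
next
  fix T assume "T \<in> pos ` faces L"
  then obtain G where G: "G \<in> faces L" "T = pos G" by blast
  have "\<exists>E\<in>exposed_faces L. pos G face_of pos E"
  proof (cases "G = L")
    case True
    then show ?thesis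
      using conv' by (intro bexI[of _ L]) (simp_all add: exposed_faces_def pos_self face_of_refl)
  next
    case False
    then obtain x where x: "x \<in> K" "G \<subseteq> conj_face K {x}" using face_subset_conj_face[OF G(1)] by blast
    have "G face_of conj_face K {x}"
      using G(1) x(2) conj_face_subset by (auto simp: faces_def intro: face_of_subset)
    then have "pos G face_of pos (conj_face K {x})"
      by (rule pos_face_of[where x = x]) (simp add: mem_conj_face)
    with x(1) show ?thesis using conj_face_singleton_exposed by blast
  qed
  with G show "T \<in> touching_cones K" by (auto simp: touching_cones_def normal_cones_eq)
qed

lemma normal_cone_rel_interior:
  assumes "F \<in> faces K" "x \<in> rel_interior F"
  shows "normal_cone K x = pos (conj_face K F)"
proof -
  have F: "F \<subseteq> K" "convex F" using assms(1) face_subset face_convex by blast+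
  then have "x \<in> K" using assms(2) rel_interior_subset by blast
  then show ?thesis
    by (simp add: normal_cone_eq conj_face_rel_interior[OF F assms(2)])
qed

lemma Psi_eq:
  assumes F: "F \<in> faces K"
  shows "Psi K F = pos (conj_face K F)"
proof (cases "F = {}")
  case False
  then have "rel_interior F \<noteq> {}" using face_convex[OF F] by (simp add: rel_interior_eq_empty)
  then have "(SOME x. x \<in> rel_interior F) \<in> rel_interior F" by (rule some_in_eq[THEN iffD2])
  then show ?thesis using False normal_cone_rel_interior[OF F] by (simp add: Psi_def)
qed (simp add: Psi_def pos_self)

lemma Psi_indep: "Psi_indep K"
  unfolding Psi_indep_def
  using face_convex by (auto simp: Psi_eq normal_cone_rel_interior rel_interior_eq_empty)

text \<open>A point \<open>x\<close> of \<open>K\<close> with value \<open>1\<close> on \<open>G\<close> realises the support function at every vector of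
  \<open>pos G\<close>. A point of \<open>K\<close> that agrees with \<open>x\<close> at the relative interior vector \<open>u\<close> therefore agrees
  with it on the whole cone.\<close>

lemma support_plane_rel_interior_pos:
  assumes G: "G \<in> faces L" "G \<noteq> L" and u: "u \<in> rel_interior (pos G)" "u \<noteq> 0"
  shows "K \<inter> support_plane K u = conj_face L G"
proof -
  obtain x where x: "x \<in> K" "G \<subseteq> conj_face K {x}" using face_subset_conj_face[OF G] by blast
  have GL: "G \<subseteq> L" using G(1) by (rule swap.face_subset)
  have max: "y \<bullet> v \<le> x \<bullet> v" if y: "y \<in> K" and v: "v \<in> pos G" for y v
  proof -
    consider "v = 0" | c g where "0 < c" "g \<in> G" "v = c *\<^sub>R g" using v by (auto simp: mem_pos)
    then show ?thesis
    proof cases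
      case 2
      then have "y \<bullet> g \<le> 1" "x \<bullet> g = 1" using inner_le_1[OF y] x(2) GL by (auto simp: mem_conj_face)
      with 2 show ?thesis by simp
    qed simp
  qed
  have uG: "u \<in> pos G" using u(1) rel_interior_subset by blast
  then have h: "support_fun K u = x \<bullet> u" using x(1) max by (intro support_fun_eq)
  obtain c g where g: "0 < c" "g \<in> G" "u = c *\<^sub>R g" using uG u(2) by (auto simp: mem_pos)
  show ?thesis
  proof (intro equalityI subsetI)
    fix y assume "y \<in> K \<inter> support_plane K u"
    then have y: "y \<in> K" "y \<bullet> u = x \<bullet> u" by (auto simp: support_plane_def h)
    \<comment> \<open>\<open>y - x\<close> is a linear functional on the cone with maximal value \<open>0\<close> at an inner point.\<close>
    have *: "(y - x) \<bullet> v = 0" if "v \<in> G" for v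
    proof (rule linear_max_rel_interior[OF _ _ u(1)])
      show "convex (pos G)" by (rule convex_pos[OF swap.face_convex[OF G(1)]])
      show "(y - x) \<bullet> w \<le> 0" if "w \<in> pos G" for w
        using max[OF y(1) that] by (simp add: inner_diff_left)
      show "(y - x) \<bullet> u = 0" using y(2) by (simp add: inner_diff_left)
      show "v \<in> pos G" using that subset_pos by blast
    qed
    then have "v \<bullet> y = 1" if "v \<in> G" for v
      using *[OF that] that x(2) by (auto simp: mem_conj_face inner_diff_left inner_diff_right inner_commute)
    then show "y \<in> conj_face L G" using y(1) by (simp add: swap.mem_conj_face)
  next
    fix y assume "y \<in> conj_face L G"
    then have "y \<in> K" "g \<bullet> y = 1" "x \<bullet> g = 1"
      using g(2) x(2) by (auto simp: swap.mem_conj_face mem_conj_face)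
    then show "y \<in> K \<inter> support_plane K u"
      by (simp add: support_plane_def h) (simp add: g(3) inner_commute)
  qed
qed

text \<open>If \<open>0\<close> were relatively interior to the cone, take \<open>x \<in> K\<close> with value \<open>1\<close> on \<open>G\<close>: the
  functional \<open>- x\<close> has its maximum over the cone at \<open>0\<close>, so it would vanish on the cone.\<close>

lemma rel_interior_pos_nonzero:
  assumes G: "G \<in> faces L" "G \<noteq> L" "G \<noteq> {}"
  shows "\<exists>u\<in>rel_interior (pos G). u \<noteq> 0"
proof (rule ccontr)
  assume contra: "\<not> ?thesis"
  obtain x where x: "G \<subseteq> conj_face K {x}" using face_subset_conj_face[OF G(1,2)] by blast
  have cv: "convex (pos G)" by (rule convex_pos[OF swap.face_convex[OF G(1)]])
  then obtain u where "u \<in> rel_interior (pos G)"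
    using rel_interior_eq_empty[OF cv] pos_ne_empty by blast
  with contra have zero: "0 \<in> rel_interior (pos G)" by (cases "u = 0") auto
  obtain g where g: "g \<in> G" using G(3) by blast
  have "(- x) \<bullet> g = 0"
  proof (rule linear_max_rel_interior[OF cv _ zero])
    show "(- x) \<bullet> w \<le> 0" if "w \<in> pos G" for w
      using inner_pos[OF x that] by (cases "w = 0") auto
    show "g \<in> pos G" using g subset_pos by blast
  qed simp
  moreover have "x \<bullet> g = 1" using g x by (auto simp: mem_conj_face)
  ultimately show False by simp
qed

lemma pos_eq_zero_iff: "G \<in> faces L \<Longrightarrow> pos G = {0} \<longleftrightarrow> G = {}"
  using pos_subset_iff[of G "{}"] empty_face_of by (auto simp: faces_def pos_def[of "{}"])

lemma Phi_pos:
  assumes G: "G \<in> faces L"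
  shows "Phi K (pos G) = conj_face L G"
proof (cases "G = {} \<or> G = L")
  case True
  then show ?thesis
    using pos_eq_zero_iff[OF G] by (auto simp: Phi_def pos_self pos_def[of "{}"])
next
  case False
  let ?u = "SOME u. u \<in> rel_interior (pos G) \<and> u \<noteq> 0"
  have "\<exists>u. u \<in> rel_interior (pos G) \<and> u \<noteq> 0"
    using rel_interior_pos_nonzero[OF G] False by blast
  then have "?u \<in> rel_interior (pos G) \<and> ?u \<noteq> 0" by (rule someI_ex)
  then have "K \<inter> support_plane K ?u = conj_face L G"
    using False G by (intro support_plane_rel_interior_pos) auto
  then show ?thesis
    using False pos_eq_zero_iff[OF G] pos_face_eq_UNIV_iff[OF G] by (simp add: Phi_def)
qed

lemma Phi_indep: "Phi_indep K"
  unfolding Phi_indep_def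
proof (intro ballI conjI)
  fix T assume "T \<in> touching_cones K - {{0}, UNIV}"
  then obtain G where G: "G \<in> faces L" "T = pos G" and "pos G \<noteq> {0}" "pos G \<noteq> UNIV"
    unfolding touching_cones_eq by blast
  then have G: "G \<in> faces L" "T = pos G" "G \<noteq> L" "G \<noteq> {}"
    using pos_eq_zero_iff pos_face_eq_UNIV_iff by auto
  then show "rel_interior T - {0} \<noteq> {}" using rel_interior_pos_nonzero by blast
  show "Phi K T = K \<inter> support_plane K u" if "u \<in> rel_interior T - {0}" for u
    using that G Phi_pos support_plane_rel_interior_pos by auto
qed

lemma cl_normal_pos:
  assumes G: "G \<in> faces L"
  shows "cl_normal K (pos G) = pos (cl_exposed L G)"
proof (intro equalityI)
  have GL: "G \<subseteq> L" using G by (rule swap.face_subset)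
  have cl: "cl_exposed L G \<in> exposed_faces L" by (rule cl_exposed_in[OF GL])
  have "G \<subseteq> cl_exposed L G" by (auto simp: cl_exposed_def)
  with cl show "cl_normal K (pos G) \<subseteq> pos (cl_exposed L G)"
    unfolding cl_normal_def normal_cones_eq by (intro Inter_lower) (simp add: pos_mono)
  have "pos (cl_exposed L G) \<subseteq> pos E" if "E \<in> exposed_faces L" "pos G \<subseteq> pos E" for E
    using that pos_subset_iff[OF G exposed_imp_face[OF that(1)]] cl_exposed_subset_iff[OF GL that(1)]
    by (intro pos_mono) simp
  then show "pos (cl_exposed L G) \<subseteq> cl_normal K (pos G)"
    by (auto simp: cl_normal_def normal_cones_eq)
qed

end


section \<open>The lattices and their morphisms\<close>

context polar_pair
begin

lemma normal_eq_pos_conj_face: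
  assumes "N \<in> normal_cones K"
  shows "N = pos (conj_face K (Phi K N))"
  using assms by (auto simp: normal_cones_eq Phi_pos exposed_imp_face conj_face_conj_face)

lemma normal_imp_touching: "N \<in> normal_cones K \<Longrightarrow> N \<in> touching_cones K"
  using exposed_imp_face by (auto simp: normal_cones_eq touching_cones_eq)

lemma lattice_faces: "lattice (incl (faces K))"
proof (rule lattice_incl_Inter_closed)
  show "K \<in> faces K" using conv by (simp add: faces_def face_of_refl)
  show "\<Inter>B \<in> faces K" if "B \<subseteq> faces K" "B \<noteq> {}" for B
    using that face_of_Inter[of B K] by (auto simp: faces_def)
qed (rule face_subset)

lemma lattice_exposed_faces: "lattice (incl (exposed_faces L))"
proof (rule lattice_incl_Inter_closed)
  show "L \<in> exposed_faces L" by (simp add: exposed_faces_eq_conj_face)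
  show "E \<subseteq> L" if "E \<in> exposed_faces L" for E by (rule exposed_subset[OF that])
  fix B assume B: "B \<subseteq> exposed_faces L" "B \<noteq> {}"
  have "\<Inter>B = conj_face K (\<Union>E\<in>B. conj_face L E)"
  proof (intro equalityI subsetI)
    fix v assume v: "v \<in> \<Inter>B"
    then have "v \<in> L" using B exposed_subset by blast
    with v show "v \<in> conj_face K (\<Union>E\<in>B. conj_face L E)"
      by (auto simp: mem_conj_face swap.mem_conj_face inner_commute)
  next
    fix v assume v: "v \<in> conj_face K (\<Union>E\<in>B. conj_face L E)"
    have "v \<in> conj_face K (conj_face L E)" if "E \<in> B" for E
      using v that by (auto simp: mem_conj_face)
    then show "v \<in> \<Inter>B" using B(1) conj_face_conj_face by blast
  qed
  then show "\<Inter>B \<in> exposed_faces L"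
    using swap.conj_face_subset by (auto intro!: conj_face_exposed)
qed

end

context polar_pair
begin

lemma lattice_touching_cones: "lattice (incl (touching_cones K))"
  unfolding touching_cones_eq
  by (rule lattice_incl_image[OF swap.lattice_faces pos_subset_iff])

lemma lattice_normal_cones: "lattice (incl (normal_cones K))"
  unfolding normal_cones_eq
  by (rule lattice_incl_image[OF lattice_exposed_faces pos_subset_iff])
    (auto intro: exposed_imp_face)

lemma conj_face_in: "F \<in> faces K \<Longrightarrow> conj_face K F \<in> exposed_faces L"
  by (simp add: conj_face_exposed face_subset)

lemma cl_exposed_face_in: "F \<in> faces K \<Longrightarrow> cl_exposed K F \<in> exposed_faces K"
  by (simp add: swap.cl_exposed_in face_subset)

lemma Phi_in: "T \<in> touching_cones K \<Longrightarrow> Phi K T \<in> exposed_faces K"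
  using swap.conj_face_exposed[OF swap.face_subset] by (auto simp: touching_cones_eq Phi_pos)

lemma Psi_in: "F \<in> faces K \<Longrightarrow> Psi K F \<in> normal_cones K"
  by (simp add: Psi_eq normal_cones_eq conj_face_in)

lemma cl_normal_in: "T \<in> touching_cones K \<Longrightarrow> cl_normal K T \<in> normal_cones K"
  by (auto simp: touching_cones_eq normal_cones_eq cl_normal_pos intro!: cl_exposed_in swap.face_subset)

lemma pos_face_in: "F \<in> faces L \<Longrightarrow> pos F \<in> touching_cones K"
  by (simp add: touching_cones_eq)

lemma pos_exposed_in: "E \<in> exposed_faces L \<Longrightarrow> pos E \<in> normal_cones K"
  by (simp add: normal_cones_eq)

lemma cl_normal_normal: "N \<in> normal_cones K \<Longrightarrow> cl_normal K N = N"
  by (auto simp: normal_cones_eq cl_normal_pos exposed_imp_face cl_exposed_exposed)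

lemma cl_normal_morphism:
  "isotone_join_morphism (incl (touching_cones K)) (incl (normal_cones K)) (cl_normal K)"
  by (rule left_adjoint_isotone_join_morphism[OF lattice_touching_cones lattice_normal_cones, where g = id])
    (use normal_imp_touching cl_normal_in in \<open>auto simp: cl_normal_def\<close>)

lemma cl_exposed_morphism:
  "isotone_join_morphism (incl (faces K)) (incl (exposed_faces K)) (cl_exposed K)"
  by (rule left_adjoint_isotone_join_morphism[OF lattice_faces swap.lattice_exposed_faces, where g = id])
    (use swap.exposed_imp_face cl_exposed_face_in in \<open>auto simp: cl_exposed_def\<close>)

text \<open>Through \<open>pos\<close>, this is the Galois connection of the two conjugate face maps. Here the cone ranges
  over all touching cones and in \<open>Psi_Phi_galois\<close> the face over all faces, so that each of \<open>Phi\<close> and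
  \<open>Psi\<close> is covered on its whole domain.\<close>

lemma Phi_Psi_galois:
  assumes T: "T \<in> touching_cones K" and E: "E \<in> exposed_faces K"
  shows "E \<subseteq> Phi K T \<longleftrightarrow> T \<subseteq> Psi K E"
proof -
  obtain G where G: "G \<in> faces L" "T = pos G" using T by (auto simp: touching_cones_eq)
  have EK: "E \<subseteq> K" "E \<in> faces K" using E swap.exposed_subset swap.exposed_imp_face by blast+
  have "E \<subseteq> Phi K T \<longleftrightarrow> E \<subseteq> conj_face L G" by (simp add: G Phi_pos)
  also have "\<dots> \<longleftrightarrow> G \<subseteq> conj_face K E"
    using conj_face_galois[OF EK(1) swap.face_subset[OF G(1)]] by simp
  also have "\<dots> \<longleftrightarrow> T \<subseteq> Psi K E"
    using pos_subset_iff[OF G(1) exposed_imp_face[OF conj_face_in[OF EK(2)]]] by (simp add: G Psi_eq EK)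
  finally show ?thesis .
qed

lemma Psi_Phi_galois:
  assumes F: "F \<in> faces K" and N: "N \<in> normal_cones K"
  shows "N \<subseteq> Psi K F \<longleftrightarrow> F \<subseteq> Phi K N"
proof -
  obtain E where E: "E \<in> exposed_faces L" "N = pos E" using N by (auto simp: normal_cones_eq)
  have "N \<subseteq> Psi K F \<longleftrightarrow> E \<subseteq> conj_face K F"
    using pos_subset_iff[OF exposed_imp_face[OF E(1)] exposed_imp_face[OF conj_face_in[OF F]]]
    by (simp add: E Psi_eq F)
  also have "\<dots> \<longleftrightarrow> F \<subseteq> Phi K N"
    using conj_face_galois[OF face_subset[OF F] exposed_subset[OF E(1)]]
    by (simp add: E Phi_pos exposed_imp_face)
  finally show ?thesis .
qed

lemma Phi_Psi: "F \<in> faces K \<Longrightarrow> Phi K (Psi K F) = cl_exposed K F"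
  by (simp add: Psi_eq Phi_pos conj_face_in exposed_imp_face swap.cl_exposed_eq face_subset)

lemma Psi_Phi: "N \<in> normal_cones K \<Longrightarrow> Psi K (Phi K N) = N"
  using normal_eq_pos_conj_face[of N] Phi_in[OF normal_imp_touching, of N]
  by (simp add: Psi_eq swap.exposed_imp_face)

lemma Phi_morphism:
  "antitone_dual_join_morphism (incl (touching_cones K)) (incl (exposed_faces K)) (Phi K)"
  by (rule galois_antitone_dual_join_morphism
      [OF lattice_touching_cones swap.lattice_exposed_faces, where g = "Psi K"])
    (use Phi_in Psi_in normal_imp_touching swap.exposed_imp_face Phi_Psi_galois in auto)

lemma Phi_dual_iso:
  "dual_lattice_iso (incl (normal_cones K)) (incl (exposed_faces K)) (Phi K)"
  by (rule inverse_galois_dual_lattice_iso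
      [OF lattice_normal_cones swap.lattice_exposed_faces, where g = "Psi K"])
    (use Phi_in Psi_in normal_imp_touching swap.exposed_imp_face Phi_Psi_galois Phi_Psi Psi_Phi
      swap.cl_exposed_exposed in auto)

lemma Psi_morphism:
  "antitone_dual_join_morphism (incl (faces K)) (incl (normal_cones K)) (Psi K)"
  by (rule galois_antitone_dual_join_morphism
      [OF lattice_faces lattice_normal_cones, where g = "Phi K"])
    (use Phi_in Psi_in normal_imp_touching swap.exposed_imp_face Psi_Phi_galois in auto)

lemma Psi_dual_iso:
  "dual_lattice_iso (incl (exposed_faces K)) (incl (normal_cones K)) (Psi K)"
  by (rule inverse_galois_dual_lattice_iso
      [OF swap.lattice_exposed_faces lattice_normal_cones, where g = "Phi K"])
    (use Phi_in Psi_in normal_imp_touching swap.exposed_imp_face Psi_Phi_galois Phi_Psi Psi_Phi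
      swap.cl_exposed_exposed in auto)

lemma conj_face_morphism:
  "antitone_dual_join_morphism (incl (faces K)) (incl (exposed_faces L)) (conj_face K)"
  by (rule galois_antitone_dual_join_morphism
      [OF lattice_faces lattice_exposed_faces, where g = "conj_face L"])
    (use conj_face_in swap.conj_face_exposed exposed_subset swap.exposed_imp_face face_subset
      conj_face_galois in auto)

lemma conj_face_dual_iso:
  "dual_lattice_iso (incl (exposed_faces K)) (incl (exposed_faces L)) (conj_face K)"
  by (rule inverse_galois_dual_lattice_iso
      [OF swap.lattice_exposed_faces lattice_exposed_faces, where g = "conj_face L"])
    (use conj_face_in swap.conj_face_exposed exposed_subset swap.exposed_imp_face face_subset
      conj_face_galois conj_face_conj_face swap.conj_face_conj_face in auto)

lemma pos_iso_faces: "lattice_iso (incl (faces L)) (incl (touching_cones K)) pos"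
  by (rule order_iso_lattice_iso[OF swap.lattice_faces lattice_touching_cones])
    (auto simp: touching_cones_eq pos_subset_iff intro!: inj_on_imp_bij_betw inj_on_pos)

lemma pos_iso_exposed: "lattice_iso (incl (exposed_faces L)) (incl (normal_cones K)) pos"
proof (rule order_iso_lattice_iso[OF lattice_exposed_faces lattice_normal_cones])
  have "inj_on pos (exposed_faces L)"
    using inj_on_pos by (rule inj_on_subset) (use exposed_imp_face in blast)
  then show "bij_betw pos (carrier (incl (exposed_faces L))) (carrier (incl (normal_cones K)))"
    by (simp add: normal_cones_eq inj_on_imp_bij_betw)
qed (use exposed_imp_face in \<open>simp add: pos_subset_iff\<close>)

end

section \<open>Commutativity of the diagram\<close>

lemma body_polar_pair:
  assumes "polar_pair K (polar K)"
  shows "polar_pair (body K s) (body K (opp s))"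
proof -
  interpret polar_pair K "polar K" by (rule assms)
  show ?thesis by (cases s) (simp_all add: polar_pair_axioms swap.polar_pair_axioms)
qed

lemma arrow_in_diagram_obj:
  assumes K: "polar_pair K (polar K)" and arr: "diagram_arrow K v f w"
    and A: "A \<in> diagram_obj K v"
  shows "f A \<in> diagram_obj K w"
proof -
  interpret s: polar_pair "body K s" "body K (opp s)" for s by (rule body_polar_pair[OF K])
  from arr A show ?thesis
    by cases (auto intro: s.cl_normal_in s.Phi_in s.cl_exposed_face_in s.Psi_in s.conj_face_in
        s.swap.pos_face_in s.swap.pos_exposed_in s.normal_imp_touching s.swap.exposed_imp_face)
qed

text \<open>\<open>to_exposed\<close> sends every object of one side to the exposed faces of that side, and
  \<open>to_primal\<close> conjugates exposed faces of the polar back to \<open>K\<close>. Their composition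
  \<open>exposed_trace\<close> is the invariant that proves commutativity.\<close>

fun to_exposed :: "'a::euclidean_space set \<Rightarrow> kind \<Rightarrow> 'a set \<Rightarrow> 'a set" where
  "to_exposed C Faces A = cl_exposed C A"
| "to_exposed C Exposed A = A"
| "to_exposed C Touching A = Phi C A"
| "to_exposed C Normal A = Phi C A"

fun to_primal :: "'a::euclidean_space set \<Rightarrow> side \<Rightarrow> 'a set \<Rightarrow> 'a set" where
  "to_primal K Primal E = E"
| "to_primal K Dual E = conj_face (polar K) E"

definition exposed_trace :: "'a::euclidean_space set \<Rightarrow> kind \<times> side \<Rightarrow> 'a set \<Rightarrow> 'a set" where
  "exposed_trace K v A = to_primal K (snd v) (to_exposed (body K (snd v)) (fst v) A)"

lemma to_primal_conj_face:
  assumes K: "polar_pair K (polar K)" and F: "F \<in> faces (body K s)"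
  shows "to_primal K (opp s) (conj_face (body K s) F) = to_primal K s (cl_exposed (body K s) F)"
proof -
  interpret polar_pair K "polar K" by (rule K)
  show ?thesis
    using F by (cases s) (simp_all add: swap.cl_exposed_eq face_subset
        swap.conj_face_cl_exposed swap.face_subset)
qed

lemma arrow_preserves_trace:
  assumes K: "polar_pair K (polar K)" and arr: "diagram_arrow K v f w"
    and A: "A \<in> diagram_obj K v"
  shows "exposed_trace K w (f A) = exposed_trace K v A"
proof -
  interpret s: polar_pair "body K s" "body K (opp s)" for s by (rule body_polar_pair[OF K])
  note conj = to_primal_conj_face[OF K]
  from arr show ?thesis
  proof cases
    case (cl_normal s)
    with A obtain G where G: "G \<in> faces (body K (opp s))" "A = pos G"
      by (auto simp: s.touching_cones_eq)
    with cl_normal show ?thesis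
      by (simp add: exposed_trace_def s.cl_normal_pos s.Phi_pos s.exposed_imp_face s.cl_exposed_in
          s.swap.face_subset s.swap.conj_face_cl_exposed)
  next
    case (pos_faces s)
    with A show ?thesis
      by (simp add: exposed_trace_def conj s.swap.Phi_pos)
  next
    case (pos_exposed s)
    with A show ?thesis
      by (simp add: exposed_trace_def conj s.swap.Phi_pos s.swap.exposed_imp_face s.swap.cl_exposed_exposed)
  qed (use A in \<open>auto simp: exposed_trace_def conj s.Phi_Psi s.swap.exposed_imp_face
      s.swap.cl_exposed_exposed\<close>)
qed

lemma path_preserves_trace:
  assumes K: "polar_pair K (polar K)" and path: "diagram_path K v f w"
    and A: "A \<in> diagram_obj K v"
  shows "f A \<in> diagram_obj K w \<and> exposed_trace K w (f A) = exposed_trace K v A"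
  using path A
proof induction
  case (single v f w)
  then show ?case using arrow_in_diagram_obj[OF K] arrow_preserves_trace[OF K] by blast
next
  case (snoc v f w g x)
  then show ?case
    using arrow_in_diagram_obj[OF K snoc.hyps(2)] arrow_preserves_trace[OF K snoc.hyps(2)] by auto
qed

lemma inj_on_trace:
  assumes K: "polar_pair K (polar K)" and k: "k = Exposed \<or> k = Normal"
  shows "inj_on (exposed_trace K (k, s)) (diagram_obj K (k, s))"
proof -
  interpret polar_pair K "polar K" by (rule K)
  interpret s: polar_pair "body K s" "body K (opp s)" by (rule body_polar_pair[OF K])
  have primal: "inj_on (to_primal K s) (exposed_faces (body K s))"
  proof (cases s)
    case Dual
    then show ?thesis
      by (intro inj_on_inverseI[of _ "conj_face K"]) (simp add: conj_face_conj_face)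
  qed (simp add: inj_on_def)
  show ?thesis
  proof (cases "k = Exposed")
    case True
    with primal show ?thesis by (simp add: exposed_trace_def[abs_def])
  next
    case False
    with k have k: "k = Normal" by simp
    show ?thesis
    proof (rule inj_onI)
      fix M N assume "M \<in> diagram_obj K (k, s)" "N \<in> diagram_obj K (k, s)"
        and eq: "exposed_trace K (k, s) M = exposed_trace K (k, s) N"
      then have MN: "M \<in> normal_cones (body K s)" "N \<in> normal_cones (body K s)" using k by auto
      then have "Phi (body K s) M = Phi (body K s) N"
        using eq k inj_onD[OF primal] by (simp add: exposed_trace_def s.Phi_in s.normal_imp_touching)
      then show "M = N" using s.Psi_Phi[OF MN(1)] s.Psi_Phi[OF MN(2)] by metis
    qed
  qed
qed

lemma no_arrow_to_faces: "\<not> diagram_arrow K v f (Faces, s)"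
  by (auto elim: diagram_arrow.cases)

lemma no_path_to_faces: "\<not> diagram_path K v f (Faces, s)"
proof
  assume "diagram_path K v f (Faces, s)"
  then show False by cases (simp_all add: no_arrow_to_faces)
qed

lemma path_to_touching:
  assumes "diagram_path K v f (Touching, s)"
  shows "f = pos"
  using assms
proof cases
  case single
  then show ?thesis by cases
next
  case (snoc f' w g)
  from snoc(3) have "\<exists>t. w = (Faces, t)" by cases auto
  with snoc(2) no_path_to_faces show ?thesis by blast
qed

lemma diagram_well_defined_polar:
  assumes K: "polar_pair K (polar K)"
  shows "diagram_well_defined K"
proof -
  interpret s: polar_pair "body K s" "body K (opp s)" for s by (rule body_polar_pair[OF K])
  show ?thesis
    using s.Phi_indep s.Psi_indep arrow_in_diagram_obj[OF K]
    by (auto simp: diagram_well_defined_def)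
qed

lemma diagram_commutes_polar:
  assumes K: "polar_pair K (polar K)"
  shows "diagram_commutes K"
  unfolding diagram_commutes_def
proof (intro allI impI ballI)
  fix v w f g A
  assume f: "diagram_path K v f w" and g: "diagram_path K v g w" and A: "A \<in> diagram_obj K v"
  obtain k s where w: "w = (k, s)" by (cases w)
  show "f A = g A"
  proof (cases k)
    case Faces
    with f w no_path_to_faces show ?thesis by blast
  next
    case Touching
    with f g w path_to_touching show ?thesis by blast
  qed (use inj_onD[OF inj_on_trace[OF K, of k s]] path_preserves_trace[OF K f A]
      path_preserves_trace[OF K g A] w in auto)
qed

theorem proposition4p1:
  fixes K :: "(real ^ 'n) set"
  assumes "compact K" and "convex K" and "0 \<in> interior K"
  shows
    "(diagram_well_defined K \<and> diagram_commutes K) \<and>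
     (\<forall>X\<in>{K, polar K}.
        isotone_join_morphism (incl (touching_cones X)) (incl (normal_cones X)) (cl_normal X) \<and>
        (\<forall>N\<in>normal_cones X. cl_normal X N = N) \<and>
        isotone_join_morphism (incl (faces X)) (incl (exposed_faces X)) (cl_exposed X) \<and>
        (\<forall>E\<in>exposed_faces X. cl_exposed X E = E)) \<and>
     (\<forall>(X, Y)\<in>{(K, polar K), (polar K, K)}.
        antitone_dual_join_morphism (incl (touching_cones X)) (incl (exposed_faces X)) (Phi X) \<and>
        dual_lattice_iso (incl (normal_cones X)) (incl (exposed_faces X)) (Phi X) \<and>
        antitone_dual_join_morphism (incl (faces X)) (incl (normal_cones X)) (Psi X) \<and>
        dual_lattice_iso (incl (exposed_faces X)) (incl (normal_cones X)) (Psi X) \<and>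
        antitone_dual_join_morphism (incl (faces X)) (incl (exposed_faces Y)) (conj_face X) \<and>
        dual_lattice_iso (incl (exposed_faces X)) (incl (exposed_faces Y)) (conj_face X)) \<and>
     (\<forall>(X, Y)\<in>{(K, polar K), (polar K, K)}.
        lattice_iso (incl (faces X)) (incl (touching_cones Y)) pos \<and>
        lattice_iso (incl (exposed_faces X)) (incl (normal_cones Y)) pos)"
proof -
  have K: "polar_pair K (polar K)" by (rule polar_pair_polar[OF assms])
  interpret polar_pair K "polar K" by (rule K)
  show ?thesis
    using diagram_well_defined_polar[OF K] diagram_commutes_polar[OF K]
      cl_normal_morphism swap.cl_normal_morphism cl_normal_normal swap.cl_normal_normal
      cl_exposed_morphism swap.cl_exposed_morphism cl_exposed_exposed swap.cl_exposed_exposed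
      Phi_morphism swap.Phi_morphism Phi_dual_iso swap.Phi_dual_iso
      Psi_morphism swap.Psi_morphism Psi_dual_iso swap.Psi_dual_iso
      conj_face_morphism swap.conj_face_morphism conj_face_dual_iso swap.conj_face_dual_iso
      pos_iso_faces swap.pos_iso_faces pos_iso_exposed swap.pos_iso_exposed
    by simp
qed

end
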